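(* Let $G$ be a $2$-group of order $2^{\lambda}$. (1) If $\lambda \geq 5$ and $G$ is not isomorphic to the cyclic group $C_{2^{\lambda}}$, then $\lvert\mathfrak{s}(G)\rvert \geq 3\lambda-1$, with equality if and only if $G \cong C_{2^{\lambda-1}} \times C_2$ or $G \cong M_{2^{\lambda}}$. (2) If $\lambda = 3$ and $G \not\cong C_8$, then $\lvert\mathfrak{s}(G)\rvert \geq 6$, with equality if and only if $G \cong Q_8$. (3) If $\lambda = 4$ and $G \not\cong C_{16}$, then $\lvert\mathfrak{s}(G)\rvert \geq 11$, with equality if and only if $G \cong Q_{16}$, or $G \cong M_{16}$, or $G \cong C_8 \times C_2$.
   Context: For a finite group $G$, $\mathfrak{s}(G)$ denotes the set of all subgroups of $G$ (including the trivial subgroup and $G$ itself), so $\lvert\mathfrak{s}(G)\rvert$ is the total number of subgroups of $G$. $C_n$ denotes the cyclic group of order $n$. In presentations, $a^b = b^{-1}ab$. The group $M_{2^{\lambda}}$ (here used for $\lambda \geq 4$) is $$M_{2^{\lambda}} = \left\langle a,b \mid a^{2^{\lambda-1}} = b^2 = 1,\ a^b = a^{1+2^{\lambda-2}} \right\rangle,$$ and $Q_{2^{\lambda}}$ (for $\lambda \geq 3$) is the generalised quaternion group of order $2^{\lambda}$, $$Q_{2^{\lambda}} = \left\langle x,y \mid x^{2^{\lambda-1}} = 1,\ y^2 = x^{2^{\lambda-2}},\ x^y = x^{-1} \right\rangle.$$ *)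

theory Defs
  imports "HOL-Algebra.Algebra"
begin

text \<open>
  Groups given by generators and relations. The generators are all the elements of the
  type \<open>'x\<close>. A word is a list of letters; the letter \<open>(x, True)\<close> stands for the generator
  \<open>x\<close> and \<open>(x, False)\<close> for its formal inverse. A relation \<open>u = v\<close> is the pair \<open>(u, v)\<close>.
\<close>

type_synonym 'x gword = "('x \<times> bool) list"

definition wgen :: "'x \<Rightarrow> 'x gword" where
  "wgen x = [(x, True)]"

definition winv :: "'x gword \<Rightarrow> 'x gword" where
  "winv w = rev (map (\<lambda>(x, e). (x, \<not> e)) w)"

definition wpow :: "'x gword \<Rightarrow> nat \<Rightarrow> 'x gword" where
  "wpow w n = concat (replicate n w)"

text \<open>The convention for conjugation is \<open>u\<^sup>v = v\<^sup>-\<^sup>1 u v\<close>.\<close>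

definition wconj :: "'x gword \<Rightarrow> 'x gword \<Rightarrow> 'x gword" where
  "wconj u v = winv v @ u @ v"

inductive pres_eq :: "('x gword \<times> 'x gword) set \<Rightarrow> 'x gword \<Rightarrow> 'x gword \<Rightarrow> bool"
  for R where
  rel: "(u, v) \<in> R \<Longrightarrow> pres_eq R u v"
| cancel: "pres_eq R [(x, e), (x, \<not> e)] []"
| refl: "pres_eq R u u"
| sym: "pres_eq R u v \<Longrightarrow> pres_eq R v u"
| trans: "pres_eq R u v \<Longrightarrow> pres_eq R v w \<Longrightarrow> pres_eq R u w"
| append: "pres_eq R u u' \<Longrightarrow> pres_eq R v v' \<Longrightarrow> pres_eq R (u @ v) (u' @ v')"

definition pres_class :: "('x gword \<times> 'x gword) set \<Rightarrow> 'x gword \<Rightarrow> 'x gword set" where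
  "pres_class R u = {v. pres_eq R u v}"

definition presented_group :: "('x gword \<times> 'x gword) set \<Rightarrow> 'x gword set monoid" where
  "presented_group R =
     \<lparr>carrier = range (pres_class R),
      monoid.mult = (\<lambda>A B. \<Union>u\<in>A. \<Union>v\<in>B. pres_class R (u @ v)),
      one = pres_class R []\<rparr>"

lemma pres_class_eq_iff: "pres_class R u = pres_class R v \<longleftrightarrow> pres_eq R u v"
proof
  assume "pres_class R u = pres_class R v"
  moreover have "v \<in> pres_class R v"
    by (simp add: pres_class_def pres_eq.refl)
  ultimately have "v \<in> pres_class R u"
    by simp
  then show "pres_eq R u v"
    by (simp add: pres_class_def)
next
  assume uv: "pres_eq R u v"
  show "pres_class R u = pres_class R v"
    unfolding pres_class_def using pres_eq.trans[OF uv] pres_eq.trans[OF pres_eq.sym[OF uv]]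
    by blast
qed

lemma presented_group_carrier: "carrier (presented_group R) = range (pres_class R)"
  by (simp add: presented_group_def)

lemma presented_group_one: "\<one>\<^bsub>presented_group R\<^esub> = pres_class R []"
  by (simp add: presented_group_def)

lemma presented_group_mult:
  "pres_class R u \<otimes>\<^bsub>presented_group R\<^esub> pres_class R v = pres_class R (u @ v)"
proof -
  have "pres_class R (u' @ v') = pres_class R (u @ v)"
    if "u' \<in> pres_class R u" "v' \<in> pres_class R v" for u' v'
    using that unfolding pres_class_eq_iff
    by (simp add: pres_class_def pres_eq.append pres_eq.sym)
  moreover have "u \<in> pres_class R u" "v \<in> pres_class R v"
    by (auto simp: pres_class_def intro: pres_eq.refl)
  ultimately have "(\<Union>u'\<in>pres_class R u. \<Union>v'\<in>pres_class R v. pres_class R (u' @ v')) =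
      pres_class R (u @ v)"
    by fast
  then show ?thesis
    by (simp add: presented_group_def)
qed

lemma pres_eq_winv: "pres_eq R (winv u @ u) []"
proof (induction u)
  case Nil
  show ?case by (simp add: winv_def pres_eq.refl)
next
  case (Cons l u)
  obtain x e where l: "l = (x, e)" by (cases l)
  have "pres_eq R [(x, \<not> e), (x, e)] []"
    using pres_eq.cancel[of R x "\<not> e"] by simp
  then have "pres_eq R ([(x, \<not> e), (x, e)] @ u) ([] @ u)"
    by (rule pres_eq.append) (rule pres_eq.refl)
  then have "pres_eq R (winv u @ ([(x, \<not> e), (x, e)] @ u)) (winv u @ ([] @ u))"
    by (rule pres_eq.append[OF pres_eq.refl])
  then have "pres_eq R (winv (l # u) @ l # u) (winv u @ u)"
    by (simp add: winv_def l)
  then show ?case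
    using Cons.IH by (rule pres_eq.trans)
qed

lemma group_presented_group: "group (presented_group R)"
proof (rule groupI)
  fix A assume "A \<in> carrier (presented_group R)"
  then obtain u where u: "A = pres_class R u"
    by (auto simp: presented_group_carrier)
  have "pres_class R (winv u) \<otimes>\<^bsub>presented_group R\<^esub> A = \<one>\<^bsub>presented_group R\<^esub>"
    by (simp add: u presented_group_mult presented_group_one pres_class_eq_iff pres_eq_winv)
  then show "\<exists>B\<in>carrier (presented_group R). B \<otimes>\<^bsub>presented_group R\<^esub> A = \<one>\<^bsub>presented_group R\<^esub>"
    by (auto simp: presented_group_carrier)
qed (auto simp: presented_group_carrier presented_group_one presented_group_mult)

datatype two_gens = Gen_a | Gen_b

text \<open>
  The parameter of the next two groups is the exponent \<open>l\<close>, so the groups themselves have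
  order \<open>2 ^ l\<close>; they are meant for \<open>l \<ge> 4\<close> and \<open>l \<ge> 3\<close> respectively.
\<close>

definition M_group :: "nat \<Rightarrow> two_gens gword set monoid" where
  "M_group l =
     (let a = wgen Gen_a; b = wgen Gen_b in
      presented_group
        {(wpow a (2 ^ (l - 1)), []),
         (wpow b 2, []),
         (wconj a b, wpow a (1 + 2 ^ (l - 2)))})"

definition Q_group :: "nat \<Rightarrow> two_gens gword set monoid" where
  "Q_group l =
     (let x = wgen Gen_a; y = wgen Gen_b in
      presented_group
        {(wpow x (2 ^ (l - 1)), []),
         (wpow y 2, wpow x (2 ^ (l - 2))),
         (wconj x y, winv x)})"

definition subgroups_of :: "('a, 'b) monoid_scheme \<Rightarrow> 'a set set" where
  "subgroups_of G = {H. subgroup H G}"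

end

theory Submission
  imports Defs
begin

text \<open>
  A noncyclic 2-group has, besides any subgroup \<open>M\<close> of index two, at least two further ones, so it
  has at least three more subgroups than \<open>M\<close>. For order at least 16 one can take \<open>M\<close> noncyclic,
  and the lower bounds follow by induction from small orders; there one distinguishes whether
  the group contains a Klein four-group or has a unique involution, in which case it is quaternion.
  If \<open>G\<close> has exactly three more subgroups than \<open>M\<close>, then every element outside \<open>M\<close> generates one of
  the two other subgroups of index two, so \<open>G\<close> has two distinct cyclic subgroups of index two, and a
  direct computation yields generators \<open>a\<close>, \<open>b\<close> satisfying the relations of \<open>C \<times> C\<^sub>2\<close> or \<open>M\<close>.
  Conversely, in a group with a cyclic subgroup \<open>A = \<langle>a\<rangle>\<close> of index two a subgroup \<open>H\<close> not contained
  in \<open>A\<close> is determined by \<open>H \<inter> A\<close> and the coset of \<open>H \<inter> A\<close> that makes up \<open>H - A\<close>; counting the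
  possible pairs bounds the number of subgroups from above.
\<close>

section \<open>Subgroups of index two in 2-groups\<close>

text \<open>The bound 3l - 1 equals 5, the count for the Klein four-group, at l = 2 and then grows
  by exactly three per doubling of the order. Groups containing a four-group therefore admit an
  induction from order 4 in which the four-group is kept inside M. Generalised quaternion groups are
  the obstacle: Q_8 has 6 < 8 subgroups and all its subgroups of index two are cyclic, so an
  induction through noncyclic M can only start at order 16. Even there the step from Q_8 yields only
  6 + 3 = 9, so 11 has to come from a separate count of the cyclic subgroups of order four outside a
  cyclic subgroup of order eight. The same gap explains the extra equality case in order 16:
  deducing an increment of exactly three requires the bound 3(l - 1) - 1 for M, which for M of order
  8 is available only in the presence of a four-group. From order 32 on every noncyclic M satisfies
  it.\<close>

definition index_two :: "('a, 'b) monoid_scheme \<Rightarrow> 'a set \<Rightarrow> bool" where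
  "index_two G M \<longleftrightarrow> subgroup M G \<and> M \<noteq> carrier G \<and>
     (\<forall>x\<in>carrier G. \<forall>y\<in>carrier G. x \<otimes>\<^bsub>G\<^esub> y \<in> M \<longleftrightarrow> (x \<in> M \<longleftrightarrow> y \<in> M))"

text \<open>The four-group is given by two generating involutions, so the property passes to every
  subgroup that contains both of them.\<close>

definition has_klein :: "('a, 'b) monoid_scheme \<Rightarrow> bool" where
  "has_klein G \<longleftrightarrow> (\<exists>s\<in>carrier G. \<exists>t\<in>carrier G. s \<noteq> t \<and> s \<noteq> \<one>\<^bsub>G\<^esub> \<and> t \<noteq> \<one>\<^bsub>G\<^esub> \<and>
     s \<otimes>\<^bsub>G\<^esub> s = \<one>\<^bsub>G\<^esub> \<and> t \<otimes>\<^bsub>G\<^esub> t = \<one>\<^bsub>G\<^esub> \<and> s \<otimes>\<^bsub>G\<^esub> t = t \<otimes>\<^bsub>G\<^esub> s)"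

text \<open>Orbit lengths divide a power of two, so every orbit that is not a single fixed point has
  even length. If \<open>x\<close> were the only fixed point, \<open>E\<close> would have an odd
  number of elements.\<close>

lemma (in group_action) second_fixed_point:
  assumes ord: "order G = 2 ^ m" and fin: "finite E" and ev: "even (card E)"
    and x: "x \<in> E" "\<And>g. g \<in> carrier G \<Longrightarrow> \<phi> g x = x"
  shows "\<exists>y\<in>E. y \<noteq> x \<and> (\<forall>g\<in>carrier G. \<phi> g y = y)"
proof (rule ccontr)
  assume contra: "\<not> ?thesis"
  have no: "\<exists>g\<in>carrier G. \<phi> g y \<noteq> y" if "y \<in> E" "y \<noteq> x" for y
    using contra that by blast
  let ?O = "orbits G E \<phi>"
  interpret G: group G using group_hom by (simp add: group_hom_def)
  have finO: "finite ?O" using fin by (simp add: orbits_def setcompr_eq_image)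
  have subE: "Q \<subseteq> E" if "Q \<in> ?O" for Q using that orbits_coverture by blast
  have "orbit G \<phi> x = {x}" using x(2) G.one_closed by (force simp: orbit_def)
  then have xO: "{x} \<in> ?O" using x(1) by (auto simp: orbits_def)
  have even: "even (card Q)" if Q: "Q \<in> ?O - {{x}}" for Q
  proof (rule ccontr)
    assume odd: "odd (card Q)"
    obtain y where y: "y \<in> E" "Q = orbit G \<phi> y" using Q by (auto simp: orbits_def)
    have "card Q dvd 2 ^ m"
      using orbit_stabilizer_theorem[OF y(1)] ord y(2) by (metis dvd_triv_left)
    then obtain k where "card Q = 2 ^ k" by (metis divides_primepow_nat two_is_prime_nat)
    with odd have "card Q = 1" by simp
    then have Qy: "Q = {y}" using orbit_refl[OF y(1)] y(2) by (metis card_1_singletonE singletonD)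
    then have "\<phi> g y = y" if "g \<in> carrier G" for g using that y(2) by (auto simp: orbit_def)
    with no y(1) have "y = x" by blast
    with Qy Q show False by simp
  qed
  have "card E = (\<Sum>Q\<in>?O. card Q)"
    using disjoint_sum[OF fin, of "\<lambda>_. 1::nat"] by simp
  also have "\<dots> = card {x} + (\<Sum>Q\<in>?O - {{x}}. card Q)"
    by (rule sum.remove[OF finO xO])
  moreover have "even (\<Sum>Q\<in>?O - {{x}}. card Q)" using even by (intro dvd_sum)
  ultimately have "odd (card E)" by simp
  with ev show False by simp
qed

section \<open>Normalizers and maximal subgroups of 2-groups\<close>

locale two_group = group G for G (structure) +
  fixes l :: nat
  assumes order_two_power: "order G = 2 ^ l"
begin

lemma fin: "finite (carrier G)"
  using order_two_power order_gt_0_iff_finite by simp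

lemma card_carrier: "card (carrier G) = 2 ^ l"
  using order_two_power by (simp add: order_def)

lemma ord_two_power:
  assumes "x \<in> carrier G" obtains m where "m \<le> l" "ord x = 2 ^ m"
  using ord_dvd_group_order[OF assms] order_two_power
  by (metis divides_primepow_nat two_is_prime_nat)

lemma subgroup_two_power:
  assumes "subgroup H G" obtains m where "m \<le> l" "card H = 2 ^ m"
proof -
  have "card H dvd 2 ^ l"
    using lagrange[OF assms] order_two_power by (metis dvd_triv_right)
  then show ?thesis
    using that by (metis divides_primepow_nat two_is_prime_nat)
qed

lemma two_group_subgroup:
  assumes "subgroup H G" "card H = 2 ^ m"
  shows "two_group (G\<lparr>carrier := H\<rparr>) m"
  using assms subgroup_imp_group by (simp add: two_group_def two_group_axioms_def order_def)

lemma inv_nat_pow: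
  assumes "x \<in> carrier G" obtains k :: nat where "inv x = x [^] k"
proof -
  have "x [^] (2 ^ l :: nat) = \<one>"
    using pow_order_eq_1[OF assms] order_two_power by simp
  then have "x [^] (2 ^ l - 1 :: nat) \<otimes> x = \<one>"
    by (metis One_nat_def Suc_pred nat_pow_Suc zero_less_numeral zero_less_power)
  then have "inv x = x [^] (2 ^ l - 1 :: nat)"
    using assms by (intro inv_equality) auto
  then show ?thesis using that by blast
qed

text \<open>The inverse turns right multiplication into a left action, and \<open>restrict\<close>
  supplies the extensionality that \<open>BijGroup\<close> demands. Since only \<open>H\<close>
  acts, the coset \<open>H\<close> is itself a fixed point.\<close>

lemma coset_action:
  assumes H: "subgroup H G"
  shows "group_action (G\<lparr>carrier := H\<rparr>) (rcosets H) (\<lambda>h. restrict (\<lambda>C. C #> inv h) (rcosets H))"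
proof -
  let ?E = "rcosets H" and ?\<phi> = "\<lambda>h. restrict (\<lambda>C. C #> inv h) (rcosets H)"
  have HG: "H \<subseteq> carrier G" using H by (rule subgroup.subset)
  have EG: "C \<subseteq> carrier G" if "C \<in> ?E" for C
    by (rule subgroup.rcosets_carrier[OF H is_group that])
  have cl: "C #> g \<in> ?E" if C: "C \<in> ?E" and g: "g \<in> carrier G" for C g
  proof -
    obtain a where a: "a \<in> carrier G" "C = H #> a" using C by (auto simp: RCOSETS_def)
    then have "C #> g = H #> (a \<otimes> g)" using g HG by (simp add: coset_mult_assoc)
    then show ?thesis using a g by (auto simp: RCOSETS_def)
  qed
  have comp: "C #> g #> h = C #> (g \<otimes> h)" if "C \<in> ?E" "g \<in> carrier G" "h \<in> carrier G" for C g h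
    using that EG by (simp add: coset_mult_assoc)
  have bij: "bij_betw (?\<phi> h) ?E ?E" if h: "h \<in> H" for h
  proof (rule bij_betwI[where g = "\<lambda>C. C #> h"])
    have hG: "h \<in> carrier G" using h HG by auto
    show "?\<phi> h \<in> ?E \<rightarrow> ?E" "(\<lambda>C. C #> h) \<in> ?E \<rightarrow> ?E" using cl hG by auto
    show "?\<phi> h C #> h = C" if "C \<in> ?E" for C
      using that hG EG by (simp add: comp coset_mult_one)
    show "?\<phi> h (C #> h) = C" if "C \<in> ?E" for C
      using that hG EG by (simp add: comp cl coset_mult_one)
  qed
  have "?\<phi> \<in> hom (G\<lparr>carrier := H\<rparr>) (BijGroup ?E)"
  proof (rule homI)
    fix h assume "h \<in> carrier (G\<lparr>carrier := H\<rparr>)"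
    then show "?\<phi> h \<in> carrier (BijGroup ?E)" using bij by (simp add: BijGroup_def Bij_def)
  next
    fix g h assume "g \<in> carrier (G\<lparr>carrier := H\<rparr>)" "h \<in> carrier (G\<lparr>carrier := H\<rparr>)"
    then have gh: "g \<in> H" "h \<in> H" by auto
    have "?\<phi> (g \<otimes> h) C = compose ?E (?\<phi> g) (?\<phi> h) C" for C
      using gh HG by (auto simp: compose_def comp cl inv_mult_group subset_iff)
    then have "?\<phi> (g \<otimes> h) = compose ?E (?\<phi> g) (?\<phi> h)" by blast
    then show "?\<phi> (g \<otimes>\<^bsub>G\<lparr>carrier := H\<rparr>\<^esub> h) = ?\<phi> g \<otimes>\<^bsub>BijGroup ?E\<^esub> ?\<phi> h"
      using bij gh by (simp add: BijGroup_def Bij_def)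
  qed
  then show ?thesis
    unfolding group_action_def group_hom_def group_hom_axioms_def
    using subgroup_imp_group[OF H] group_BijGroup by blast
qed

text \<open>A coset \<open>H #> g\<close> is fixed under the action of \<open>H\<close> only if
  \<open>g\<close> normalizes \<open>H\<close>. One fixed point is \<open>H\<close>; the number of
  cosets is even, so there is a second one, and its representative is the desired element.\<close>

lemma normalizer_grows:
  assumes H: "subgroup H G" and ne: "H \<noteq> carrier G"
  obtains g where "g \<in> carrier G" "g \<notin> H" "\<And>h. h \<in> H \<Longrightarrow> g \<otimes> h \<otimes> inv g \<in> H"
proof -
  let ?E = "rcosets H" and ?\<phi> = "\<lambda>h. restrict (\<lambda>C. C #> inv h) (rcosets H)" and ?S = "G\<lparr>carrier := H\<rparr>"
  interpret act: group_action ?S ?E ?\<phi> using H by (rule coset_action)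
  have HG: "H \<subseteq> carrier G" using H by (rule subgroup.subset)
  obtain m where m: "m \<le> l" "card H = 2 ^ m" using subgroup_two_power[OF H] .
  have finE: "finite ?E"
    using rcosets_subset_PowG[OF H] fin by (meson finite_Pow_iff finite_subset)
  have "card ?E * 2 ^ m = 2 ^ l" using lagrange[OF H] m order_two_power by simp
  moreover have "m \<noteq> l"
    using m ne card_subset_eq[OF fin HG] card_carrier by auto
  then have "2 ^ l = 2 ^ (l - m) * (2 ^ m :: nat)" and "l - m > 0"
    using m by (simp_all flip: power_add)
  ultimately have cE: "even (card ?E)" by simp
  have HE: "H \<in> ?E" using HG coset_mult_one[OF HG] by (metis one_closed rcosetsI)
  have HH: "?\<phi> h H = H" if "h \<in> H" for h
    using that HE H HG by (simp add: coset_join2 subgroup.m_inv_closed subset_iff)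
  obtain C where C: "C \<in> ?E" "C \<noteq> H" "\<And>h. h \<in> H \<Longrightarrow> ?\<phi> h C = C"
    using act.second_fixed_point[of m, OF _ finE cE HE] HH m(2) unfolding order_def
    by (metis partial_object.select_convs(1) partial_object.surjective partial_object.update_convs(1))
  obtain g where g: "g \<in> carrier G" "C = H #> g" using C(1) by (auto simp: RCOSETS_def)
  have "g \<notin> H" using C(2) g H by (metis coset_join2)
  moreover have "g \<otimes> h \<otimes> inv g \<in> H" if h: "h \<in> H" for h
  proof -
    have hG: "h \<in> carrier G" and ih: "inv h \<in> H"
      using h HG H by (auto simp: subgroup.m_inv_closed)
    have "C #> h = C" using C(3)[OF ih] C(1) hG by simp
    then have "H #> (g \<otimes> h) = H #> g" using g hG HG by (simp add: coset_mult_assoc)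
    moreover have "g \<otimes> h \<in> H #> (g \<otimes> h)" using rcos_self[OF _ H] g hG by simp
    ultimately obtain k where k: "k \<in> H" "g \<otimes> h = k \<otimes> g" by (auto simp: r_coset_def)
    then have "g \<otimes> h \<otimes> inv g = k" using g HG by (simp add: m_assoc subset_iff)
    then show ?thesis using k by simp
  qed
  ultimately show ?thesis using that g by blast
qed

text \<open>The repeated squares of a normalizing element start outside \<open>H\<close> and end at
  the identity. The last one outside \<open>H\<close> has its square in \<open>H\<close>, so
  adjoining it enlarges \<open>H\<close> exactly by a factor of two.\<close>

lemma normalizer_step:
  assumes H: "subgroup H G" and ne: "H \<noteq> carrier G"
  obtains x where "x \<in> carrier G" "x \<notin> H" "x \<otimes> x \<in> H" "\<And>h. h \<in> H \<Longrightarrow> x \<otimes> h \<otimes> inv x \<in> H"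
proof -
  obtain g where g: "g \<in> carrier G" "g \<notin> H" "\<And>h. h \<in> H \<Longrightarrow> g \<otimes> h \<otimes> inv g \<in> H"
    using normalizer_grows[OF H ne] by metis
  have nrm: "g [^] (n::nat) \<otimes> h \<otimes> inv (g [^] n) \<in> H" if h: "h \<in> H" for n h
  proof (induction n)
    case 0 then show ?case using h H by (simp add: subgroup.mem_carrier)
  next
    case (Suc n)
    have "g [^] Suc n \<otimes> h \<otimes> inv (g [^] Suc n) = g \<otimes> (g [^] n \<otimes> h \<otimes> inv (g [^] n)) \<otimes> inv g"
      using g(1) h H by (simp only: nat_pow_Suc2)
        (simp add: inv_mult_group m_assoc subgroup.mem_carrier)
    then show ?case using g(3)[OF Suc.IH] by simp
  qed
  define P where "P i \<longleftrightarrow> g [^] (2 ^ i :: nat) \<in> H" for i :: nat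
  have "P l" unfolding P_def
    using pow_order_eq_1[OF g(1)] order_two_power H by (simp add: subgroup.one_closed)
  moreover have "\<not> P 0" using g by (simp add: P_def)
  ultimately obtain i where i: "\<not> P i" "P (Suc i)"
    using ex_least_nat_less[of P l] by blast
  have "g [^] (2 ^ i :: nat) \<otimes> g [^] (2 ^ i :: nat) \<in> H"
    using i(2) g(1) by (simp add: P_def nat_pow_mult mult_2)
  with i(1) nrm g(1) show ?thesis
    by (intro that[of "g [^] (2 ^ i :: nat)"]) (auto simp: P_def)
qed

text \<open>A maximal proper subgroup \<open>M\<close> above \<open>H\<close> is enlarged by
  \<open>normalizer_step\<close> to the union of two cosets; by maximality this union is the whole
  group.\<close>

lemma in_index_two:
  assumes H: "subgroup H G" and ne: "H \<noteq> carrier G"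
  obtains M where "index_two G M" "H \<subseteq> M"
proof -
  define S where "S = {K. subgroup K G \<and> K \<noteq> carrier G}"
  have "S \<subseteq> Pow (carrier G)" unfolding S_def by (auto dest: subgroup.subset)
  then have finS: "finite S" using fin by (meson finite_Pow_iff finite_subset)
  have HS: "H \<in> S" using H ne by (simp add: S_def)
  obtain M where M: "M \<in> S" "H \<subseteq> M" and max: "\<And>K. K \<in> S \<Longrightarrow> M \<subseteq> K \<Longrightarrow> M = K"
    using finite_has_maximal2[OF finS HS] by auto
  then have MS: "subgroup M G" "M \<noteq> carrier G" by (auto simp: S_def)
  interpret M: subgroup M G by (rule MS(1))
  obtain x where x: "x \<in> carrier G" "x \<notin> M" "x \<otimes> x \<in> M" "\<And>h. h \<in> M \<Longrightarrow> x \<otimes> h \<otimes> inv x \<in> M"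
    using normalizer_step[OF MS] by metis
  have sw: "\<exists>h'\<in>M. x \<otimes> h = h' \<otimes> x" if "h \<in> M" for h
    using x(4)[OF that] x(1) that by (intro bexI[of _ "x \<otimes> h \<otimes> inv x"]) (auto simp: m_assoc)
  let ?T = "M \<union> {h \<otimes> x | h. h \<in> M}"
  have mx: "a \<otimes> x \<otimes> (b \<otimes> x) \<in> M" if "a \<in> M" "b \<in> M" for a b
  proof -
    obtain b' where "b' \<in> M" "x \<otimes> b = b' \<otimes> x" using sw \<open>b \<in> M\<close> by blast
    then have "a \<otimes> x \<otimes> (b \<otimes> x) = a \<otimes> b' \<otimes> (x \<otimes> x)"
      using that x(1) M.mem_carrier by (metis m_assoc m_closed)
    then show ?thesis using that \<open>b' \<in> M\<close> x(3) by simp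
  qed
  have ax: "a \<otimes> x \<otimes> b \<in> {h \<otimes> x | h. h \<in> M}" if "a \<in> M" "b \<in> M" for a b
  proof -
    obtain b' where "b' \<in> M" "x \<otimes> b = b' \<otimes> x" using sw \<open>b \<in> M\<close> by blast
    then have "a \<otimes> x \<otimes> b = a \<otimes> b' \<otimes> x" using that x(1) by (simp add: m_assoc)
    then show ?thesis using that \<open>b' \<in> M\<close> by blast
  qed
  have closed: "u \<otimes> v \<in> ?T" if uv: "u \<in> ?T" "v \<in> ?T" for u v
  proof -
    consider "u \<in> M" "v \<in> M" | a where "u \<in> M" "a \<in> M" "v = a \<otimes> x" |
      a where "v \<in> M" "a \<in> M" "u = a \<otimes> x" | a b where "a \<in> M" "b \<in> M" "u = a \<otimes> x" "v = b \<otimes> x"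
      using uv by blast
    then show ?thesis
    proof cases
      case 2 then have "u \<otimes> v = (u \<otimes> a) \<otimes> x" using x(1) by (simp add: m_assoc)
      then show ?thesis using 2 by blast
    qed (use mx ax in auto)
  qed
  have TG: "?T \<subseteq> carrier G" using x(1) by auto
  have "subgroup ?T G"
  proof (rule subgroupI[OF TG])
    show "?T \<noteq> {}" using M.one_closed by blast
    fix u assume u: "u \<in> ?T"
    then have uG: "u \<in> carrier G" using TG by blast
    \<comment> \<open>Inverses are positive powers in a finite group, so closure under products
      suffices.\<close>
    obtain k :: nat where "inv u = u [^] k" using inv_nat_pow[OF uG] .
    moreover have "u [^] n \<in> ?T" for n :: nat by (induction n) (use closed u in simp_all)
    ultimately show "inv u \<in> ?T" by simp
  qed (rule closed)
  moreover have "x \<in> ?T" using l_one[OF x(1)] M.one_closed by (metis (mono_tags, lifting) CollectI UnI2)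
  moreover have "M \<subseteq> ?T" by blast
  ultimately have T: "?T = carrier G" using max[of ?T] x(2) unfolding S_def by (metis (mono_tags, lifting) mem_Collect_eq)
  have "index_two G M"
    unfolding index_two_def
  proof (intro conjI ballI)
    fix u v assume uv: "u \<in> carrier G" "v \<in> carrier G"
    have "u \<otimes> v \<in> M" if "u \<notin> M" "v \<notin> M"
    proof -
      have "u \<in> ?T" "v \<in> ?T" using uv T by simp_all
      with that obtain a b where "a \<in> M" "u = a \<otimes> x" "b \<in> M" "v = b \<otimes> x" by auto
      then show ?thesis using mx by simp
    qed
    moreover have "u \<otimes> v \<notin> M" if "u \<notin> M" "v \<in> M"
    proof
      assume "u \<otimes> v \<in> M"
      then have "u \<otimes> v \<otimes> inv v \<in> M" using that by simp
      with uv that show False by (simp add: m_assoc)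
    qed
    moreover have "u \<otimes> v \<notin> M" if "u \<in> M" "v \<notin> M"
    proof
      assume "u \<otimes> v \<in> M"
      then have "inv u \<otimes> (u \<otimes> v) \<in> M" using that by simp
      with uv that show False by (simp flip: m_assoc)
    qed
    ultimately show "u \<otimes> v \<in> M \<longleftrightarrow> (u \<in> M \<longleftrightarrow> v \<in> M)" by auto
  qed (use MS in auto)
  with M(2) show ?thesis using that by blast
qed

end

section \<open>Subgroups of index two and Klein four-groups in the count\<close>

context group
begin

text \<open>Left multiplication by an element outside \<open>M\<close> exchanges \<open>M\<close>
  and its complement.\<close>

lemma index_two_card:
  assumes fin: "finite (carrier G)" and M: "index_two G M"
  shows "card (carrier G) = 2 * card M"
proof -
  have sub: "subgroup M G" and MG: "M \<subseteq> carrier G"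
    using M by (auto simp: index_two_def dest: subgroup.subset)
  obtain x where x: "x \<in> carrier G" "x \<notin> M" using M MG by (auto simp: index_two_def)
  have cl: "x \<otimes> y \<in> M \<longleftrightarrow> y \<notin> M" if "y \<in> carrier G" for y
    using M x that by (auto simp: index_two_def)
  have "bij_betw (\<lambda>y. x \<otimes> y) M (carrier G - M)"
  proof (rule bij_betw_imageI)
    show "inj_on (\<lambda>y. x \<otimes> y) M" using x MG by (meson inj_onI l_cancel subsetD)
    show "(\<lambda>y. x \<otimes> y) ` M = carrier G - M"
    proof (intro equalityI subsetI)
      fix y assume "y \<in> carrier G - M"
      then have "x \<otimes> (inv x \<otimes> y) = y" "inv x \<otimes> y \<in> carrier G" "y \<notin> M"
        using x by (auto simp flip: m_assoc)
      then have "inv x \<otimes> y \<in> M" using cl[of "inv x \<otimes> y"] by auto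
      then show "y \<in> (\<lambda>y. x \<otimes> y) ` M"
        using \<open>x \<otimes> (inv x \<otimes> y) = y\<close> by (metis image_eqI)
    qed (use cl x MG in auto)
  qed
  then have "card M = card (carrier G - M)" by (rule bij_betw_same_card)
  also have "\<dots> = card (carrier G) - card M"
    using fin MG by (simp add: card_Diff_subset finite_subset)
  finally show ?thesis using fin MG card_mono[OF fin MG] by linarith
qed

text \<open>In the form chosen for \<open>index_two\<close>, membership in \<open>M\<close> is a
  homomorphism onto a group of two elements. The set of agreement is the kernel of the product of
  two such homomorphisms, which is nontrivial because they differ.\<close>

lemma index_two_sym_diff:
  assumes M: "index_two G M" and N: "index_two G N" and ne: "M \<noteq> N"
  shows "index_two G {x \<in> carrier G. x \<in> M \<longleftrightarrow> x \<in> N}" (is "index_two G ?K")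
proof -
  have MG: "M \<subseteq> carrier G" "N \<subseteq> carrier G" and one: "\<one> \<in> M" "\<one> \<in> N"
    using M N by (auto simp: index_two_def subgroup.one_closed dest: subgroup.subset)
  have mult: "x \<otimes> y \<in> ?K \<longleftrightarrow> (x \<in> ?K \<longleftrightarrow> y \<in> ?K)" if "x \<in> carrier G" "y \<in> carrier G" for x y
    using M N that by (auto simp: index_two_def)
  have "subgroup ?K G"
  proof (rule subgroupI)
    fix x assume x: "x \<in> ?K"
    then have "x \<otimes> inv x \<in> ?K" using one by auto
    then show "inv x \<in> ?K" using mult[of x "inv x"] x by blast
  qed (use one mult in auto)
  then show ?thesis using mult ne MG by (auto simp: index_two_def)
qed

lemma subgroups_of_subgroup:
  assumes "subgroup M G"
  shows "subgroups_of (G\<lparr>carrier := M\<rparr>) = {K \<in> subgroups_of G. K \<subseteq> M}"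
proof (rule Set.set_eqI)
  fix K
  show "K \<in> subgroups_of (G\<lparr>carrier := M\<rparr>) \<longleftrightarrow> K \<in> {K \<in> subgroups_of G. K \<subseteq> M}"
    using incl_subgroup[OF assms, of K] subgroup_incl[OF _ assms, of K]
      subgroup.subset[of K "G\<lparr>carrier := M\<rparr>"]
    unfolding subgroups_of_def by (metis (no_types, lifting) mem_Collect_eq
      partial_object.select_convs(1) partial_object.simps(3) partial_object.surjective)
qed

lemma finite_subgroups_of: "finite (carrier G) \<Longrightarrow> finite (subgroups_of G)"
  by (rule finite_subset[of _ "Pow (carrier G)"]) (auto simp: subgroups_of_def dest: subgroup.subset)

end

context two_group
begin

lemma cyclic_iff: "cyclic_group G \<longleftrightarrow> (\<exists>x\<in>carrier G. generate G {x} = carrier G)"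
  unfolding cyclic_group by (rule bex_cong[OF HOL.refl]) (auto simp: generate_pow full_SetCompr_eq)

lemma generate_singleton_subgroup: "x \<in> carrier G \<Longrightarrow> subgroup (generate G {x}) G"
  by (simp add: generate_is_subgroup)

lemma cyclic_subgroup_iff:
  assumes "subgroup M G"
  shows "cyclic_group (G\<lparr>carrier := M\<rparr>) \<longleftrightarrow> (\<exists>x\<in>M. generate G {x} = M)"
proof -
  obtain m where "card M = 2 ^ m" using subgroup_two_power[OF assms] .
  then interpret M: two_group "G\<lparr>carrier := M\<rparr>" m by (rule two_group_subgroup[OF assms])
  show ?thesis unfolding M.cyclic_iff using generate_consistent[OF _ assms] by auto
qed

lemma two_group_index_two:
  assumes "index_two G M"
  shows "two_group (G\<lparr>carrier := M\<rparr>) (l - 1)" "l \<ge> 1" "card M = 2 ^ (l - 1)"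
proof -
  have M: "subgroup M G" using assms by (simp add: index_two_def)
  have c: "2 ^ l = 2 * card M" using index_two_card[OF fin assms] card_carrier by simp
  show l: "l \<ge> 1" using c by (cases l) auto
  then show "card M = 2 ^ (l - 1)" using c by (cases l) auto
  then show "two_group (G\<lparr>carrier := M\<rparr>) (l - 1)" using two_group_subgroup[OF M] by simp
qed

lemma exists_index_two:
  assumes "l \<ge> 1" obtains M where "index_two G M"
proof -
  have "(2::nat) ^ 1 \<le> card (carrier G)" unfolding card_carrier using assms by (rule power_increasing) simp
  then have "card {\<one>} \<noteq> card (carrier G)" by auto
  then have "{\<one>} \<noteq> carrier G" by metis
  then show ?thesis using in_index_two[OF triv_subgroup] that by metis
qed

end

text \<open>A chain of subgroups with successive index two already has \<open>m + 1\<close> members.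
  Cyclic groups attain this bound, and it serves where \<open>M\<close> may be cyclic.\<close>

lemma card_subgroups_ge_Suc:
  "two_group H m \<Longrightarrow> m + 1 \<le> card (subgroups_of H)"
proof (induction m arbitrary: H)
  case 0
  interpret H: two_group H 0 by fact
  have "carrier H \<in> subgroups_of H" by (simp add: subgroups_of_def H.subgroup_self)
  then show ?case using H.finite_subgroups_of[OF H.fin] by (simp add: Suc_le_eq card_gt_0_iff) blast
next
  case (Suc m)
  interpret H: two_group H "Suc m" by fact
  obtain M where M: "index_two H M" using H.exists_index_two by auto
  have MS: "subgroup M H" and ne: "M \<noteq> carrier H" using M by (auto simp: index_two_def)
  have "m + 1 \<le> card (subgroups_of (H\<lparr>carrier := M\<rparr>))"
    using Suc.IH H.two_group_index_two(1)[OF M] by simp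
  moreover have "carrier H \<in> subgroups_of H" "\<not> carrier H \<subseteq> M"
    using ne H.subgroup_self subgroup.subset[OF MS] by (auto simp: subgroups_of_def)
  then have "subgroups_of (H\<lparr>carrier := M\<rparr>) \<subset> subgroups_of H"
    unfolding H.subgroups_of_subgroup[OF MS] by blast
  then have "card (subgroups_of (H\<lparr>carrier := M\<rparr>)) < card (subgroups_of H)"
    using H.finite_subgroups_of[OF H.fin] by (rule psubset_card_mono[rotated])
  ultimately show ?case by simp
qed

context two_group
begin

text \<open>For \<open>x\<close> outside \<open>M\<close> the cyclic group of \<open>x\<close> is
  proper and so lies in some \<open>M1\<close> of index two, different from \<open>M\<close>. The
  third subgroup is the set of agreement of \<open>M\<close> and \<open>M1\<close>; any two of the
  three then meet inside the remaining one.\<close>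

lemma noncyclic_index_two:
  assumes nc: "\<not> cyclic_group G" and M: "index_two G M"
  obtains M1 M2 where "index_two G M1" "index_two G M2" "M1 \<noteq> M" "M2 \<noteq> M" "M1 \<noteq> M2"
    "\<not> M1 \<subseteq> M" "\<not> M2 \<subseteq> M" "M1 \<inter> M2 \<subseteq> M"
proof -
  have MG: "M \<subseteq> carrier G" using M by (auto simp: index_two_def dest: subgroup.subset)
  obtain x where x: "x \<in> carrier G" "x \<notin> M" using M MG by (auto simp: index_two_def)
  have "generate G {x} \<noteq> carrier G" using nc x cyclic_iff by blast
  then obtain M1 where M1: "index_two G M1" "generate G {x} \<subseteq> M1"
    using in_index_two[OF generate_singleton_subgroup[OF x(1)]] by metis
  have xM: "x \<in> M1" using M1(2) generate.incl[of x "{x}" G] by blast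
  then have ne: "M \<noteq> M1" using x by blast
  let ?K = "{y \<in> carrier G. y \<in> M \<longleftrightarrow> y \<in> M1}"
  have K: "index_two G ?K" using index_two_sym_diff[OF M M1(1) ne] .
  have sub: "subgroup M1 G" "subgroup M G" using M M1 by (auto simp: index_two_def)
  have "\<not> M \<subseteq> M1"
    using ne two_group_index_two(3)[OF M] two_group_index_two(3)[OF M1(1)] fin
      subgroup.subset[OF sub(1)] by (metis card_subset_eq finite_subset)
  then obtain y where y: "y \<in> M" "y \<notin> M1" by blast
  have xy: "x \<otimes> y \<in> carrier G" "x \<otimes> y \<notin> M" "x \<otimes> y \<notin> M1"
    using x y M M1(1) xM MG by (auto simp: index_two_def)
  then have "x \<otimes> y \<in> ?K" by simp
  with xy x xM ne show ?thesis
    by (intro that[OF M1(1) K]) auto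
qed

text \<open>The three subgroups outside \<open>M\<close> are the whole group, \<open>M1\<close> and
  \<open>M2\<close>. If there are no others, an element outside \<open>M\<close> can only generate
  \<open>M1\<close> or \<open>M2\<close>. As \<open>M1 \<inter> M2 \<subseteq> M\<close>, an element
  of \<open>M1\<close> outside \<open>M\<close> generates \<open>M1\<close>, and likewise for
  \<open>M2\<close>.\<close>

lemma
  assumes nc: "\<not> cyclic_group G" and M: "index_two G M"
  shows card_subgroups_index_two_ge: "card (subgroups_of (G\<lparr>carrier := M\<rparr>)) + 3 \<le> card (subgroups_of G)"
    and card_subgroups_index_two_eq:
     "card (subgroups_of G) = card (subgroups_of (G\<lparr>carrier := M\<rparr>)) + 3 \<Longrightarrow>
     \<exists>x\<in>carrier G. \<exists>y\<in>carrier G. index_two G (generate G {x}) \<and> index_two G (generate G {y}) \<and>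
        generate G {x} \<noteq> generate G {y}"
proof -
  obtain M1 M2 where M12: "index_two G M1" "index_two G M2" "M1 \<noteq> M" "M2 \<noteq> M" "M1 \<noteq> M2"
    "\<not> M1 \<subseteq> M" "\<not> M2 \<subseteq> M" "M1 \<inter> M2 \<subseteq> M" using noncyclic_index_two[OF nc M] .
  have MS: "subgroup M G" and sub: "subgroup M1 G" "subgroup M2 G" "M1 \<noteq> carrier G" "M2 \<noteq> carrier G"
    using M M12 by (auto simp: index_two_def)
  let ?A = "subgroups_of (G\<lparr>carrier := M\<rparr>)" and ?B = "{carrier G, M1, M2}"
  have A: "K \<in> ?A \<longleftrightarrow> K \<in> subgroups_of G \<and> K \<subseteq> M" for K
    by (simp add: subgroups_of_subgroup[OF MS])
  have finS: "finite (subgroups_of G)" using finite_subgroups_of[OF fin] .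
  have "\<not> carrier G \<subseteq> M" using M12(6) subgroup.subset[OF sub(1)] by blast
  then have AB: "?A \<inter> ?B = {}" using A M12(6,7) by blast
  have "?B \<subseteq> subgroups_of G" using sub subgroup_self by (simp add: subgroups_of_def)
  then have AB': "?A \<union> ?B \<subseteq> subgroups_of G" using A by blast
  have "card ?B = 3" using M12 sub by auto
  then have cAB: "card (?A \<union> ?B) = card ?A + 3"
    using card_Un_disjoint[OF _ _ AB] finite_subset[OF AB' finS] by simp
  then show "card ?A + 3 \<le> card (subgroups_of G)"
    using card_mono[OF finS AB'] by simp
  assume "card (subgroups_of G) = card ?A + 3"
  then have eq: "?A \<union> ?B = subgroups_of G"
    using card_subset_eq[OF finS AB'] cAB by simp
  have gen: "generate G {x} = M1 \<or> generate G {x} = M2" if x: "x \<in> carrier G" "x \<notin> M" for x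
  proof -
    have "generate G {x} \<in> ?A \<union> ?B"
      using eq generate_singleton_subgroup[OF x(1)] by (simp add: subgroups_of_def)
    moreover have "x \<in> generate G {x}" by (simp add: generate.incl)
    then have "generate G {x} \<notin> ?A" using x A by blast
    moreover have "generate G {x} \<noteq> carrier G" using nc x cyclic_iff by blast
    ultimately show ?thesis by blast
  qed
  obtain x y where xy: "x \<in> M1" "x \<notin> M" "y \<in> M2" "y \<notin> M" using M12 by blast
  then have G: "x \<in> carrier G" "y \<in> carrier G" using sub by (auto dest: subgroup.subset)
  have "x \<in> generate G {x}" "y \<in> generate G {y}" by (simp_all add: generate.incl)
  then have "generate G {x} = M1" "generate G {y} = M2"
    using gen[OF G(1)] gen[OF G(2)] xy M12(8) by auto
  then show "\<exists>x\<in>carrier G. \<exists>y\<in>carrier G. index_two G (generate G {x}) \<and> index_two G (generate G {y}) \<and>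
        generate G {x} \<noteq> generate G {y}"
    using G M12 by metis
qed

lemma involution_in_cyclic:
  assumes a: "a \<in> carrier G" "generate G {a} = carrier G" and s: "s \<in> carrier G" "s \<noteq> \<one>" "s \<otimes> s = \<one>"
  shows "s = a [^] (2 ^ (l - 1) :: nat)"
proof -
  have orda: "ord a = 2 ^ l" using cyclic_order_is_ord[OF a(1)] generate_pow_card[OF a(1)] a(2) card_carrier by simp
  obtain i :: nat where i: "s = a [^] i" using generate_pow_nat[OF a(1)] a(2) s(1) orda by auto
  have "a [^] (i + i) = \<one>" using s(3) i a(1) by (simp add: nat_pow_mult)
  then have d: "2 ^ l dvd 2 * i" using pow_eq_id[OF a(1)] orda by (simp add: mult_2)
  have "l \<noteq> 0"
  proof
    assume "l = 0"
    then have "card (carrier G) = 1" using card_carrier by simp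
    then show False using s(1,2) one_closed by (metis card_1_singletonE singletonD)
  qed
  then obtain m where m: "l = Suc m" by (cases l) auto
  with d have "2 ^ m dvd i" by simp
  then obtain q where q: "i = 2 ^ m * q" by (auto elim: dvdE)
  have one: "a [^] (2 ^ l :: nat) = \<one>" using orda pow_ord_eq_1[OF a(1)] by simp
  have "odd q"
  proof
    assume "even q"
    then obtain r where "i = 2 ^ l * r" using q m by (auto elim: evenE)
    then have "s = \<one>" using i one a(1) by (simp flip: nat_pow_pow)
    with s(2) show False by simp
  qed
  then obtain r where "i = 2 ^ l * r + 2 ^ m" using q m by (auto elim!: oddE simp: algebra_simps)
  then have "s = (a [^] (2 ^ l :: nat)) [^] r \<otimes> a [^] (2 ^ m :: nat)"
    using i a(1) by (simp add: nat_pow_mult nat_pow_pow)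
  then show ?thesis using one a(1) m by simp
qed

lemma has_klein_not_cyclic:
  assumes "has_klein G" shows "\<not> cyclic_group G"
proof
  assume "cyclic_group G"
  then obtain a where a: "a \<in> carrier G" "generate G {a} = carrier G" by (auto simp: cyclic_iff)
  obtain s t where "s \<in> carrier G" "t \<in> carrier G" "s \<noteq> t" "s \<noteq> \<one>" "t \<noteq> \<one>"
    "s \<otimes> s = \<one>" "t \<otimes> t = \<one>"
    using assms unfolding has_klein_def by metis
  then show False using involution_in_cyclic[OF a] by metis
qed

end

text \<open>For \<open>l \<ge> 3\<close> the four-group is too small to be everything, so it lies in
  a subgroup of index two.\<close>

lemma klein_subgroup:
  assumes "two_group G l" "l \<ge> 3" and k: "has_klein G"
  obtains M where "index_two G M" "has_klein (G\<lparr>carrier := M\<rparr>)"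
proof -
  interpret two_group G l by fact
  obtain s t where st: "s \<in> carrier G" "t \<in> carrier G" "s \<noteq> t" "s \<noteq> \<one>\<^bsub>G\<^esub>" "t \<noteq> \<one>\<^bsub>G\<^esub>"
     "s \<otimes>\<^bsub>G\<^esub> s = \<one>\<^bsub>G\<^esub>" "t \<otimes>\<^bsub>G\<^esub> t = \<one>\<^bsub>G\<^esub>" "t \<otimes>\<^bsub>G\<^esub> s = s \<otimes>\<^bsub>G\<^esub> t"
    using k unfolding has_klein_def by metis
  let ?V = "{\<one>\<^bsub>G\<^esub>, s, t, s \<otimes>\<^bsub>G\<^esub> t}"
  have ss: "s \<otimes>\<^bsub>G\<^esub> (s \<otimes>\<^bsub>G\<^esub> x) = x" "t \<otimes>\<^bsub>G\<^esub> (t \<otimes>\<^bsub>G\<^esub> x) = x"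
    "t \<otimes>\<^bsub>G\<^esub> (s \<otimes>\<^bsub>G\<^esub> x) = s \<otimes>\<^bsub>G\<^esub> (t \<otimes>\<^bsub>G\<^esub> x)" if "x \<in> carrier G" for x
    using st that by (simp_all flip: m_assoc)
  have iv: "inv\<^bsub>G\<^esub> s = s" "inv\<^bsub>G\<^esub> t = t" using st by (auto intro: inv_equality)
  have V: "subgroup ?V G"
    by (rule subgroupI) (use st ss iv in \<open>auto simp: m_assoc inv_mult_group\<close>)
  have "card ?V \<le> 4" by (simp add: card_insert_if)
  moreover have "(2::nat) ^ 3 \<le> 2 ^ l" using assms(2) by (rule power_increasing) simp
  ultimately have "card ?V \<noteq> card (carrier G)" using card_carrier by simp
  then have "?V \<noteq> carrier G" by metis
  then obtain M where M: "index_two G M" "?V \<subseteq> M" using in_index_two[OF V] by metis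
  have "has_klein (G\<lparr>carrier := M\<rparr>)"
    unfolding has_klein_def using st(3-) M(2)
    by (intro bexI[of _ s] bexI[of _ t] conjI) auto
  with M(1) show ?thesis using that by blast
qed

text \<open>Choosing \<open>M\<close> above the four-group preserves the induction hypothesis. In
  order four no such \<open>M\<close> exists; there the chain bound gives 2 + 3 = 5.\<close>

lemma klein_card_subgroups:
  "two_group G l \<Longrightarrow> l \<ge> 2 \<Longrightarrow> has_klein G \<Longrightarrow> card (subgroups_of G) \<ge> 3 * l - 1"
proof (induction l arbitrary: G)
  case (Suc l)
  interpret two_group G "Suc l" by fact
  have nc: "\<not> cyclic_group G" using has_klein_not_cyclic Suc by simp
  show ?case
  proof (cases "l = 1")
    case True
    obtain M where M: "index_two G M" using exists_index_two by auto
    have "1 + 1 \<le> card (subgroups_of (G\<lparr>carrier := M\<rparr>))"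
      using two_group_index_two(1)[OF M] True by (intro card_subgroups_ge_Suc) simp
    then show ?thesis using card_subgroups_index_two_ge[OF nc M] True by simp
  next
    case False
    then have "Suc l \<ge> 3" using Suc by simp
    then obtain M where M: "index_two G M" "has_klein (G\<lparr>carrier := M\<rparr>)"
      using klein_subgroup[OF Suc.prems(1) _ Suc.prems(3)] by metis
    then have "3 * l - 1 \<le> card (subgroups_of (G\<lparr>carrier := M\<rparr>))"
      using two_group_index_two(1)[OF M(1)] False Suc by simp
    then show ?thesis using card_subgroups_index_two_ge[OF nc M(1)] \<open>Suc l \<ge> 3\<close> by simp
  qed
qed simp

section \<open>Metacyclic groups\<close>

text \<open>The group generated by \<open>a\<close>, \<open>b\<close> with \<open>a\<^sup>N = 1\<close>, \<open>b\<^sup>2 = a\<^sup>t\<close>, \<open>a\<^sup>b = a\<^sup>k\<close>; the order of \<open>a\<close> may be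
  smaller than \<open>N\<close> unless the group has order \<open>2 N\<close>.\<close>

definition metacyclic :: "('a, 'b) monoid_scheme \<Rightarrow> nat \<Rightarrow> nat \<Rightarrow> nat \<Rightarrow> 'a \<Rightarrow> 'a \<Rightarrow> bool" where
  "metacyclic G N t k a b \<longleftrightarrow> a \<in> carrier G \<and> b \<in> carrier G \<and> a [^]\<^bsub>G\<^esub> N = \<one>\<^bsub>G\<^esub> \<and>
     b \<otimes>\<^bsub>G\<^esub> b = a [^]\<^bsub>G\<^esub> t \<and> a \<otimes>\<^bsub>G\<^esub> b = b \<otimes>\<^bsub>G\<^esub> a [^]\<^bsub>G\<^esub> k \<and> generate G {a, b} = carrier G"

context group
begin

lemma pow_swap:
  assumes ab: "a \<in> carrier G" "b \<in> carrier G" "a \<otimes> b = b \<otimes> a [^] (k::nat)"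
  shows "a [^] (i::nat) \<otimes> b = b \<otimes> a [^] (k * i)"
proof (induction i)
  case (Suc i)
  have "a [^] Suc i \<otimes> b = a [^] i \<otimes> (a \<otimes> b)" using ab by (simp add: m_assoc)
  also have "\<dots> = (a [^] i \<otimes> b) \<otimes> a [^] k" using ab by (simp add: m_assoc)
  also have "\<dots> = b \<otimes> a [^] (k * Suc i)" using ab Suc by (simp add: m_assoc nat_pow_mult add.commute)
  finally show ?case .
qed (use ab in simp)

text \<open>This controls everything outside the cyclic group of \<open>a\<close>: zeros of the
  exponent modulo the order of \<open>a\<close> give elements of square one, zeros modulo its
  divisors restrict the subgroups not contained in that cyclic group.\<close>

lemma square_swap:
  assumes ab: "a \<in> carrier G" "b \<in> carrier G" "a \<otimes> b = b \<otimes> a [^] (k::nat)" "b \<otimes> b = a [^] (t::nat)"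
  shows "(b \<otimes> a [^] (i::nat)) \<otimes> (b \<otimes> a [^] i) = a [^] (t + (k + 1) * i)"
proof -
  have "(b \<otimes> a [^] i) \<otimes> (b \<otimes> a [^] i) = b \<otimes> (a [^] i \<otimes> b) \<otimes> a [^] i"
    using ab by (simp add: m_assoc)
  also have "\<dots> = (b \<otimes> b) \<otimes> a [^] (k * i + i)"
    using ab(1,2) by (simp add: pow_swap[OF ab(1-3)] m_assoc nat_pow_mult)
  also have "\<dots> = a [^] (t + (k + 1) * i)" using ab(1) by (simp add: ab(4) nat_pow_mult algebra_simps)
  finally show ?thesis .
qed

lemma pow_mod:
  assumes "a \<in> carrier G" "a [^] (N::nat) = \<one>"
  shows "a [^] (i::nat) = a [^] (i mod N)"
proof -
  have "a [^] i = a [^] (N * (i div N) + i mod N)" by simp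
  also have "\<dots> = (a [^] N) [^] (i div N) \<otimes> a [^] (i mod N)"
    using assms(1) by (simp only: nat_pow_mult nat_pow_pow)
  finally show ?thesis using assms by simp
qed

lemma inv_eq_pow_pred:
  assumes "a \<in> carrier G" "a [^] N = \<one>" "(N::nat) > 0"
  shows "inv a = a [^] (N - 1)"
proof (rule inv_equality)
  show "a [^] (N - 1) \<otimes> a = \<one>" using assms(2,3) by (metis Suc_diff_1 nat_pow_Suc)
qed (use assms(1) in auto)

text \<open>The set \<open>T\<close> of normal forms is stable under left multiplication by both
  generators and their inverses, hence by everything they generate. Finiteness is not presupposed,
  so the result applies to presented groups.\<close>

lemma metacyclic_elem:
  assumes m: "metacyclic G N t k a b" and N: "N > 0" and x: "x \<in> carrier G"
  shows "\<exists>i<N. x = a [^] i \<or> x = b \<otimes> a [^] i"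
proof -
  have ab: "a \<in> carrier G" "b \<in> carrier G" "a [^] N = \<one>" "b \<otimes> b = a [^] t"
    "a \<otimes> b = b \<otimes> a [^] k" and gen: "generate G {a, b} = carrier G"
    using m by (auto simp: metacyclic_def)
  define T where "T = range (\<lambda>i::nat. a [^] i) \<union> range (\<lambda>i::nat. b \<otimes> a [^] i)"
  have T: "a [^] (i::nat) \<in> T" "b \<otimes> a [^] (i::nat) \<in> T" for i by (auto simp: T_def)
  have TE: "\<exists>i::nat. u = a [^] i \<or> u = b \<otimes> a [^] i" if "u \<in> T" for u using that by (auto simp: T_def)
  have TG: "T \<subseteq> carrier G" using ab by (auto simp: T_def)
  have Tcl: "a \<otimes> u \<in> T" "b \<otimes> u \<in> T" if u: "u \<in> T" for u
  proof -
    obtain i :: nat where i: "u = a [^] i \<or> u = b \<otimes> a [^] i" using TE[OF u] by blast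
    have 1: "a \<otimes> a [^] i = a [^] Suc i" using nat_pow_Suc2[OF ab(1)] by metis
    have "a \<otimes> (b \<otimes> a [^] i) = (b \<otimes> a [^] k) \<otimes> a [^] i" using ab(1,2,5) by (simp flip: m_assoc)
    then have 2: "a \<otimes> (b \<otimes> a [^] i) = b \<otimes> a [^] (k + i)"
      using ab(1,2) by (simp add: nat_pow_mult m_assoc)
    have "b \<otimes> (b \<otimes> a [^] i) = (b \<otimes> b) \<otimes> a [^] i" using ab(1,2) by (simp add: m_assoc)
    then have 3: "b \<otimes> (b \<otimes> a [^] i) = a [^] (t + i)" using ab(1,4) by (simp add: nat_pow_mult)
    show "a \<otimes> u \<in> T" using i 1 2 T by metis
    show "b \<otimes> u \<in> T" using i 3 T by metis
  qed
  have Ta: "a [^] (n::nat) \<otimes> u \<in> T" if u: "u \<in> T" for u n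
  proof (induction n)
    case 0 then show ?case using u TG by auto
  next
    case (Suc n)
    have "u \<in> carrier G" using u TG by auto
    then have "a [^] Suc n \<otimes> u = a \<otimes> (a [^] n \<otimes> u)"
      using ab(1) nat_pow_Suc2[OF ab(1), of n] by (metis m_assoc nat_pow_closed)
    then show ?case using Tcl(1)[OF Suc] by simp
  qed
  have ia: "inv a = a [^] (N - 1)" using inv_eq_pow_pred[OF ab(1,3) N] .
  \<comment> \<open>The power \<open>a [^] ((N - 1) * t)\<close> is inverse to
    \<open>b \<otimes> b = a [^] t\<close>; multiplied by \<open>b\<close> it becomes the inverse of
    \<open>b\<close>.\<close>
  have "t + (N - 1) * t = N * t" using N by (cases N) auto
  then have "a [^] t \<otimes> a [^] ((N - 1) * t) = \<one>"
    using ab(1,3) by (simp only: nat_pow_mult) (simp flip: nat_pow_pow)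
  then have "b \<otimes> (b \<otimes> a [^] ((N - 1) * t)) = \<one>"
    using ab(1,2,4) by (simp flip: m_assoc)
  then have ib: "inv b = b \<otimes> a [^] ((N - 1) * t)"
    using ab(1,2) by (metis inv_comm inv_equality nat_pow_closed m_closed)
  have "\<forall>u\<in>T. g \<otimes> u \<in> T" if "g \<in> generate G {a, b}" for g
    using that
  proof (induction rule: generate.induct)
    case one then show ?case using TG by auto
  next
    case (incl h) then show ?case using Tcl by auto
  next
    case (inv h)
    have "inv a \<otimes> u \<in> T" if "u \<in> T" for u using Ta[OF that] ia by simp
    moreover have "inv b \<otimes> u \<in> T" if "u \<in> T" for u
    proof -
      have "u \<in> carrier G" using that TG by auto
      then show ?thesis using Tcl(2)[OF Ta[OF that]] ib ab(1,2) by (simp add: m_assoc)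
    qed
    ultimately show ?case using inv by blast
  next
    case (eng h1 h2)
    have h: "h1 \<in> carrier G" "h2 \<in> carrier G" using eng(1,2) gen by auto
    show ?case
    proof
      fix u assume "u \<in> T"
      then show "h1 \<otimes> h2 \<otimes> u \<in> T" using eng.IH TG h by (simp add: m_assoc subset_iff)
    qed
  qed
  moreover have "\<one> \<in> T" using T(1)[of 0] by simp
  ultimately have "x \<otimes> \<one> \<in> T" using x gen by blast
  then obtain i :: nat where "x = a [^] i \<or> x = b \<otimes> a [^] i" using TE x by auto
  then have "x = a [^] (i mod N) \<or> x = b \<otimes> a [^] (i mod N)"
    using pow_mod[OF ab(1,3), of i] by metis
  then show ?thesis using N mod_less_divisor by blast
qed

text \<open>For a group given by the relations this is the source of both its finiteness and its
  order bound.\<close>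

lemma metacyclic_order_le:
  assumes m: "metacyclic G N t k a b" and N: "N > 0"
  shows "finite (carrier G)" "order G \<le> 2 * N"
proof -
  have sub: "carrier G \<subseteq> (\<lambda>i. a [^] i) ` {..<N} \<union> (\<lambda>i. b \<otimes> a [^] i) ` {..<N}" (is "_ \<subseteq> ?A \<union> ?B")
  proof
    fix x assume "x \<in> carrier G"
    then obtain i where "i < N" "x = a [^] i \<or> x = b \<otimes> a [^] i" using metacyclic_elem[OF m N] by blast
    then show "x \<in> ?A \<union> ?B" by auto
  qed
  then show "finite (carrier G)" by (rule finite_subset) simp
  have "card (carrier G) \<le> card (?A \<union> ?B)" using sub by (rule card_mono[rotated]) simp
  also have "\<dots> \<le> card ?A + card ?B" by (rule card_Un_le)
  also have "\<dots> \<le> N + N" by (intro add_mono) (metis card_image_le card_lessThan finite_lessThan)+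
  finally show "order G \<le> 2 * N" by (simp add: order_def)
qed

text \<open>The cyclic group of \<open>a\<close> and its translate by \<open>b\<close> cover the
  group. Order \<open>2 * N\<close> leaves no room for a shorter cyclic group, nor for a translate
  that coincides with it.\<close>

lemma metacyclic_ord:
  assumes m: "metacyclic G N t k a b" and N: "N > 0" and o: "order G = 2 * N"
  shows "ord a = N" "b \<notin> generate G {a}"
proof -
  have ab: "a \<in> carrier G" "b \<in> carrier G" "a [^] N = \<one>" using m by (auto simp: metacyclic_def)
  have d: "ord a dvd N" using ab pow_eq_id by simp
  then have op: "ord a > 0" using N by (metis dvd_pos_nat)
  let ?P = "generate G {a}"
  have P: "?P = (\<lambda>i. a [^] i) ` (UNIV :: nat set)" using generate_pow_nat[OF ab(1)] op by auto
  have cP: "card ?P = ord a" using generate_pow_card[OF ab(1)] by simp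
  then have finP: "finite ?P" using op by (metis card.infinite less_irrefl)
  have sub: "carrier G \<subseteq> ?P \<union> (\<lambda>u. b \<otimes> u) ` ?P"
  proof
    fix x assume "x \<in> carrier G"
    then obtain i where "i < N" and i: "x = a [^] i \<or> x = b \<otimes> a [^] i" using metacyclic_elem[OF m N] by blast
    have aP: "a [^] i \<in> ?P" unfolding P by (rule rangeI)
    from i show "x \<in> ?P \<union> (\<lambda>u. b \<otimes> u) ` ?P"
    proof
      assume "x = b \<otimes> a [^] i"
      then show ?thesis using aP by (intro UnI2 image_eqI)
    qed (use aP in \<open>intro UnI1, simp only:\<close>)
  qed
  have "2 * N \<le> card (?P \<union> (\<lambda>u. b \<otimes> u) ` ?P)"
    using card_mono[OF _ sub] finP o by (simp add: order_def)
  also have "\<dots> \<le> card ?P + card ((\<lambda>u. b \<otimes> u) ` ?P)" by (rule card_Un_le)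
  also have "\<dots> \<le> ord a + ord a" using card_image_le[OF finP] cP by simp
  finally have "N \<le> ord a" by simp
  then show ord: "ord a = N" using d N by (metis dvd_imp_le le_antisym)
  show "b \<notin> ?P"
  proof
    assume "b \<in> ?P"
    then have "(\<lambda>u. b \<otimes> u) ` ?P \<subseteq> ?P" by (auto intro: generate.eng)
    then have "carrier G \<subseteq> ?P" using sub by blast
    then have "card (carrier G) \<le> N" using card_mono[OF finP] cP ord by simp
    then show False using o N by (simp add: order_def)
  qed
qed

lemma index_two_eq_carrier:
  assumes M: "index_two G M" and H: "subgroup H G" "M \<subseteq> H" "b \<in> H" "b \<notin> M"
  shows "H = carrier G"
proof
  show "carrier G \<subseteq> H"
  proof
    fix g assume g: "g \<in> carrier G"
    have b: "b \<in> carrier G" using H by (auto dest: subgroup.subset)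
    show "g \<in> H"
    proof (cases "g \<in> M")
      case False
      then have "b \<otimes> g \<in> H" using M H b g by (auto simp: index_two_def)
      then have "inv b \<otimes> (b \<otimes> g) \<in> H" using H by (simp add: subgroup.m_closed subgroup.m_inv_closed)
      then show ?thesis using b g by (simp flip: m_assoc)
    qed (use H in auto)
  qed
qed (use H in \<open>auto dest: subgroup.subset\<close>)

lemma index_two_conj:
  assumes M: "index_two G M" and x: "x \<in> M" and y: "y \<in> carrier G"
  shows "inv y \<otimes> x \<otimes> y \<in> M"
proof -
  have "x \<in> carrier G" using M x by (auto simp: index_two_def dest: subgroup.subset)
  moreover have "\<one> \<in> M" using M by (auto simp: index_two_def subgroup.one_closed)
  then have "inv y \<in> M \<longleftrightarrow> y \<in> M" using M y unfolding index_two_def by (metis inv_closed r_inv)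
  ultimately show ?thesis using M x y by (auto simp: index_two_def)
qed

lemma cyclic_index_two_action:
  assumes A: "index_two G (generate G {x})" and x: "x \<in> carrier G" "ord x = N" "N > 0"
    and y: "y \<in> carrier G"
  obtains c where "c < N" "x \<otimes> y = y \<otimes> x [^] c"
proof -
  have "inv y \<otimes> x \<otimes> y \<in> generate G {x}" by (rule index_two_conj[OF A _ y]) (simp add: generate.incl)
  then obtain c :: nat where c: "inv y \<otimes> x \<otimes> y = x [^] c"
    using generate_pow_nat[OF x(1)] x by auto
  have "x \<otimes> y = y \<otimes> (inv y \<otimes> x \<otimes> y)" using x y by (simp flip: m_assoc)
  also have "\<dots> = y \<otimes> x [^] (c mod N)" using c pow_mod[OF x(1), of N c] x by (metis pow_ord_eq_1)
  finally show ?thesis using that x(3) mod_less_divisor by blast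
qed

lemma metacyclic_index_two:
  assumes A: "index_two G (generate G {a})" and a: "a \<in> carrier G" "a [^] N = \<one>"
    and b: "b \<in> carrier G" "b \<notin> generate G {a}" "b \<otimes> b = a [^] t" "a \<otimes> b = b \<otimes> a [^] k"
  shows "metacyclic G N t k a b"
proof -
  have "generate G {a, b} = carrier G"
  proof (rule index_two_eq_carrier[OF A _ _ _ b(2)])
    show "subgroup (generate G {a, b}) G" using a b by (intro generate_is_subgroup) auto
    show "generate G {a} \<subseteq> generate G {a, b}" by (rule mono_generate) simp
    show "b \<in> generate G {a, b}" by (simp add: generate.incl)
  qed
  then show ?thesis using a b by (simp add: metacyclic_def)
qed

end

context two_group
begin

lemma ord_index_two:
  assumes "x \<in> carrier G" "index_two G (generate G {x})"
  shows "ord x = 2 ^ (l - 1)"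
  using generate_pow_card[OF assms(1)] two_group_index_two(3)[OF assms(2)] by simp

text \<open>The square of \<open>x\<close> lies in the cyclic group of \<open>y\<close> and hence
  commutes with \<open>y\<close>. If \<open>x \<otimes> y = y \<otimes> x [^] c\<close>, this forces
  2c = 2 modulo the order of \<open>x\<close>, which leaves two values of \<open>c\<close>. It
  remains to multiply \<open>y\<close> by a power of \<open>x\<close> so that the square becomes
  one.\<close>

lemma two_cyclic_metacyclic:
  assumes l: "l \<ge> 4" and x: "x \<in> carrier G" "index_two G (generate G {x})"
    and y: "y \<in> carrier G" "index_two G (generate G {y})" and ne: "generate G {x} \<noteq> generate G {y}"
  shows "\<exists>a b. metacyclic G (2 ^ (l - 1)) 0 1 a b \<or> metacyclic G (2 ^ (l - 1)) 0 (1 + 2 ^ (l - 2)) a b"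
proof -
  \<comment> \<open>For \<open>l \<ge> 4\<close> the order of \<open>x\<close> is
    \<open>8 * q\<close>, and the factor \<open>1 + 2 * q\<close> needed for the second value of
    \<open>c\<close> has a natural number \<open>q\<close>.\<close>
  define q :: nat where "q = 2 ^ (l - 4)"
  obtain m where m: "l = m + 4" using l by (metis add.commute le_Suc_ex)
  have N: "2 ^ (l - 1) = 8 * q" "2 ^ (l - 2) = 4 * q" and q0: "q > 0"
    by (simp_all add: q_def m power_add numeral_eq_Suc)
  have ordx: "ord x = 8 * q" and ordy: "ord y = 8 * q"
    using ord_index_two[OF x] ord_index_two[OF y] N by simp_all
  have yx: "y \<notin> generate G {x}"
  proof
    assume yin: "y \<in> generate G {x}"
    have "generate G {y} \<subseteq> generate G {x}"
      by (rule generate_subgroup_incl[OF _ generate_singleton_subgroup[OF x(1)]]) (use yin in simp)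
    moreover have "finite (generate G {x})"
      using fin subgroup.subset[OF generate_singleton_subgroup[OF x(1)]] by (rule finite_subset[rotated])
    ultimately show False
      using ne ordx ordy generate_pow_card[OF x(1)] generate_pow_card[OF y(1)] by (metis card_subset_eq)
  qed
  have sq: "u \<otimes> u \<in> M" if "index_two G M" "u \<in> carrier G" for M u
    using that by (auto simp: index_two_def)
  obtain c where c: "c < 8 * q" "x \<otimes> y = y \<otimes> x [^] c"
    using cyclic_index_two_action[OF x(2,1) ordx _ y(1)] q0 by auto
  obtain j :: nat where "x \<otimes> x = y [^] j"
    using sq[OF y(2) x(1)] generate_pow_nat[OF y(1)] ordy q0 by auto
  then have "x \<otimes> x \<otimes> y = y \<otimes> (x \<otimes> x)" using nat_pow_Suc[of y j] nat_pow_Suc2[OF y(1), of j] by simp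
  then have x2: "x [^] (2::nat) \<otimes> y = y \<otimes> x [^] (2::nat)" using x(1) by (simp add: numeral_2_eq_2)
  have "x [^] (c * 2) = x [^] (2::nat)"
    using x2 pow_swap[OF x(1) y(1) c(2), of 2] x(1) y(1) by simp
  then have "x [^] (int (c * 2)) = x [^] (int 2)" by (simp only: int_pow_int)
  then have "int (8 * q) dvd int (c * 2) - int 2" using int_pow_eq[OF x(1)] ordx by (simp add: dvd_diff_commute)
  then obtain r where "int (c * 2) - int 2 = int (8 * q) * r" by (auto elim: dvdE)
  then have r: "int c - 1 = 4 * int q * r" by simp
  have cc: "c = 1 \<or> c = 1 + 4 * q"
  proof -
    have "r > -1"
    proof (rule ccontr)
      assume "\<not> r > -1"
      then have "4 * int q * r \<le> 4 * int q * (-1)" by (intro mult_left_mono) auto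
      then show False using r q0 by linarith
    qed
    moreover have "r < 2"
    proof (rule ccontr)
      assume "\<not> r < 2"
      then have "4 * int q * 2 \<le> 4 * int q * r" by (intro mult_left_mono) auto
      then show False using r c(1) by linarith
    qed
    ultimately have "r = 0 \<or> r = 1" by auto
    then show ?thesis using r by auto
  qed
  obtain n' :: nat where n': "y \<otimes> y = x [^] n'"
    using sq[OF x(2) y(1)] generate_pow_nat[OF x(1)] ordx q0 by auto
  \<comment> \<open>As \<open>y\<close> has order \<open>8 * q\<close>, the power of
    \<open>y \<otimes> y\<close> with exponent \<open>4 * q\<close> is one; this makes
    \<open>n'\<close> even, so that the equation for \<open>i\<close> below is solvable.\<close>
  have "x [^] (n' * (4 * q)) = (y \<otimes> y) [^] (4 * q)" using n' x(1) by (simp add: nat_pow_pow)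
  also have "y \<otimes> y = y [^] (2::nat)" using y(1) by (simp add: numeral_2_eq_2)
  also have "\<dots> [^] (4 * q) = \<one>" using y(1) ordy by (simp add: nat_pow_pow pow_eq_id)
  finally have "8 * q dvd n' * (4 * q)" using pow_eq_id[OF x(1)] ordx by simp
  then have "even n'" using q0 by auto
  then obtain n where n: "n' = 2 * n" by (auto elim: evenE)
  \<comment> \<open>Here \<open>s\<close> stands for -1 modulo \<open>8 * q\<close>, and
    \<open>i\<close> has to solve 2n + (c + 1)i = 0. For \<open>c = 1\<close> the solution is -n.
    Otherwise c + 1 = 2(1 + 2q), and 1 + 2q is its own inverse modulo 4q.\<close>
  define s where "s = 8 * q - 1"
  have s: "Suc s = 8 * q" using q0 by (simp add: s_def)
  define i where "i = (if c = 1 then n * s else n * s * (1 + 2 * q))"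
  have "8 * q dvd 2 * n + (c + 1) * i"
  proof (cases "c = 1")
    case True
    then have "2 * n + (c + 1) * i = 2 * n * Suc s" by (simp add: i_def)
    then show ?thesis using s by simp
  next
    case False
    then have "2 * n + (c + 1) * i = 2 * n + (2 + 4 * q) * (n * s * (1 + 2 * q))" using cc by (simp add: i_def)
    also have "\<dots> = 2 * n * Suc s + 8 * q * (n * s * (1 + q))" by (simp add: algebra_simps)
    finally show ?thesis using s by simp
  qed
  then have "x [^] (n' + (c + 1) * i) = \<one>" using pow_eq_id[OF x(1)] ordx n by simp
  then have b2: "(y \<otimes> x [^] i) \<otimes> (y \<otimes> x [^] i) = x [^] (0::nat)"
    using square_swap[OF x(1) y(1) c(2) n'] by simp
  have "x \<otimes> (y \<otimes> x [^] i) = y \<otimes> (x [^] c \<otimes> x [^] i)"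
    using c(2) x(1) y(1) by (simp flip: m_assoc)
  then have act: "x \<otimes> (y \<otimes> x [^] i) = (y \<otimes> x [^] i) \<otimes> x [^] c"
    using x(1) y(1) by (simp add: nat_pow_mult m_assoc add.commute)
  have "x [^] i \<in> generate G {x}" using generate_pow_nat[OF x(1)] ordx q0 by auto
  then have bx: "y \<otimes> x [^] i \<notin> generate G {x}" using yx x y by (auto simp: index_two_def)
  have "metacyclic G (8 * q) 0 c x (y \<otimes> x [^] i)"
    using metacyclic_index_two[OF x(2,1) _ _ bx b2 act] x(1) y(1) ordx pow_ord_eq_1[OF x(1)] by simp
  then show ?thesis using cc N by metis
qed

text \<open>The four-group is spanned by \<open>b\<close> and the involution of the cyclic group of
  \<open>a\<close>. Conjugation by \<open>b\<close> raises that involution to the odd power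
  \<open>k\<close>, so it is fixed.\<close>

lemma metacyclic_has_klein:
  assumes l: "l \<ge> 2" and m: "metacyclic G (2 ^ (l - 1)) 0 k a b" and k: "odd k"
  shows "has_klein G"
proof -
  obtain n where n: "l = n + 2" using l by (metis add.commute le_Suc_ex)
  have ab: "a \<in> carrier G" "b \<in> carrier G" "b \<otimes> b = \<one>" "a \<otimes> b = b \<otimes> a [^] k" "a [^] (2 ^ (l - 1) :: nat) = \<one>"
    using m by (auto simp: metacyclic_def)
  have o: "ord a = 2 ^ (l - 1)" "b \<notin> generate G {a}"
    using metacyclic_ord[OF m] order_two_power n by simp_all
  let ?z = "a [^] (2 ^ n :: nat)"
  have zA: "?z \<in> generate G {a}" using generate_pow_nat[OF ab(1)] o by auto
  have z1: "?z \<noteq> \<one>" using pow_eq_id[OF ab(1), of "2 ^ n"] o n by (auto dest: dvd_imp_le)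
  have zz: "?z \<otimes> ?z = \<one>" using ab(1,5) n by (simp add: nat_pow_mult mult_2)
  obtain r where r: "k = 2 * r + 1" using k by (auto elim: oddE)
  have "?z \<otimes> b = b \<otimes> a [^] (k * 2 ^ n)" by (rule pow_swap[OF ab(1,2,4)])
  also have "k * 2 ^ n = 2 ^ (l - 1) * r + 2 ^ n" using n r by (simp add: algebra_simps)
  also have "a [^] \<dots> = (a [^] (2 ^ (l - 1) :: nat)) [^] r \<otimes> ?z" using ab(1) by (simp add: nat_pow_mult nat_pow_pow)
  finally have "?z \<otimes> b = b \<otimes> ?z" using ab by simp
  moreover have "b \<noteq> \<one>" using o(2) generate.one by metis
  moreover have "?z \<noteq> b" using zA o(2) by metis
  ultimately show ?thesis unfolding has_klein_def using ab z1 zz by (metis nat_pow_closed)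
qed

end

section \<open>2-groups with a unique involution\<close>

definition unique_involution :: "('a, 'b) monoid_scheme \<Rightarrow> 'a \<Rightarrow> bool" where
  "unique_involution G z \<longleftrightarrow> z \<in> carrier G \<and> z \<noteq> \<one>\<^bsub>G\<^esub> \<and> z \<otimes>\<^bsub>G\<^esub> z = \<one>\<^bsub>G\<^esub> \<and>
     (\<forall>u\<in>carrier G. u \<otimes>\<^bsub>G\<^esub> u = \<one>\<^bsub>G\<^esub> \<longrightarrow> u = \<one>\<^bsub>G\<^esub> \<or> u = z)"

context two_group
begin

lemma split_metacyclic_has_klein:
  assumes "l \<ge> 4"
    and "metacyclic G (2 ^ (l - 1)) 0 1 a b \<or> metacyclic G (2 ^ (l - 1)) 0 (1 + 2 ^ (l - 2)) a b"
  shows "has_klein G"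
  using assms(2)
proof
  have l: "l \<ge> 2" "l - 2 \<noteq> 0" using assms(1) by auto
  show "has_klein G" if "metacyclic G (2 ^ (l - 1)) 0 1 a b"
    by (rule metacyclic_has_klein[OF l(1) that]) simp
  show "has_klein G" if "metacyclic G (2 ^ (l - 1)) 0 (1 + 2 ^ (l - 2)) a b"
    by (rule metacyclic_has_klein[OF l(1) that]) (use l in simp)
qed

lemma power_involution:
  assumes x: "x \<in> carrier G" "x \<noteq> \<one>"
  obtains n :: nat where "x [^] n \<noteq> \<one>" "x [^] n \<otimes> x [^] n = \<one>"
proof -
  obtain m where m: "ord x = 2 ^ m" using ord_two_power[OF x(1)] by metis
  have "m \<noteq> 0" using m x ord_eq_1[OF x(1)] by (metis power_0)
  then obtain n where n: "m = Suc n" by (cases m) auto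
  have "x [^] (2 ^ n :: nat) \<noteq> \<one>" using pow_eq_id[OF x(1)] m n by (auto dest: dvd_imp_le)
  moreover have "x [^] (2 ^ n :: nat) \<otimes> x [^] (2 ^ n :: nat) = \<one>"
    using pow_eq_id[OF x(1)] m n x(1) by (simp add: nat_pow_mult mult_2)
  ultimately show ?thesis using that by blast
qed

lemma pow_conj:
  assumes "g \<in> carrier G" "r \<in> carrier G" "inv g \<otimes> r \<otimes> g = s"
  shows "inv g \<otimes> r [^] (n::nat) \<otimes> g = s [^] n"
proof (induction n)
  case (Suc n)
  have "inv g \<otimes> r [^] Suc n \<otimes> g = (inv g \<otimes> r [^] n \<otimes> g) \<otimes> (inv g \<otimes> r \<otimes> g)"
    using assms(1,2) by (simp add: m_assoc) (simp flip: m_assoc[of g "inv g"])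
  then show ?case using Suc assms(3) by simp
qed (use assms in simp)

text \<open>Two distinct involutions \<open>z\<close> and \<open>u\<close> both invert
  \<open>z \<otimes> u\<close>. An involution among the powers of this product is then centralized
  by both, and together with one of them that differs from it spans a four-group.\<close>

lemma unique_involution_exists:
  assumes l: "l \<ge> 1" and nk: "\<not> has_klein G"
  obtains z where "unique_involution G z"
proof -
  have "(2::nat) ^ 1 \<le> card (carrier G)" unfolding card_carrier using l by (rule power_increasing) simp
  then have "card {\<one>} \<noteq> card (carrier G)" by auto
  then have "carrier G \<noteq> {\<one>}" by metis
  then obtain x where x: "x \<in> carrier G" "x \<noteq> \<one>" using one_closed by blast
  obtain n0 :: nat where "x [^] n0 \<noteq> \<one>" "x [^] n0 \<otimes> x [^] n0 = \<one>"
    using power_involution[OF x] .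
  then obtain z where z: "z \<in> carrier G" "z \<noteq> \<one>" "z \<otimes> z = \<one>" using x(1) nat_pow_closed by metis
  have "u = z" if u: "u \<in> carrier G" "u \<noteq> \<one>" "u \<otimes> u = \<one>" for u
  proof (rule ccontr)
    assume ne: "u \<noteq> z"
    let ?r = "z \<otimes> u"
    have iv: "inv z = z" "inv u = u" using z u by (auto intro: inv_equality)
    have r: "?r \<in> carrier G" "?r \<noteq> \<one>"
      using z u ne iv by (auto simp: inv_eq_1_iff dest: inv_equality)
    obtain n :: nat where n: "?r [^] n \<noteq> \<one>" "?r [^] n \<otimes> ?r [^] n = \<one>" using power_involution[OF r] .
    let ?c = "?r [^] n"
    have c: "?c \<in> carrier G" "inv ?c = ?c" using r n by (auto intro: inv_equality)
    have ir: "inv ?r = u \<otimes> z" using iv z u by (simp add: inv_mult_group)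
    have "inv z \<otimes> ?r \<otimes> z = inv ?r" using ir iv z u by (simp flip: m_assoc)
    then have "inv z \<otimes> ?c \<otimes> z = inv ?c" using pow_conj[OF z(1) r(1)] nat_pow_inv[OF r(1)] by simp
    then have cz: "?c \<otimes> z = z \<otimes> ?c" using c z(1) iv by (metis inv_solve_left' m_assoc m_closed)
    have "inv u \<otimes> ?r \<otimes> u = inv ?r" using ir iv z u by (simp add: m_assoc)
    then have "inv u \<otimes> ?c \<otimes> u = inv ?c" using pow_conj[OF u(1) r(1)] nat_pow_inv[OF r(1)] by simp
    then have cu: "?c \<otimes> u = u \<otimes> ?c" using c u(1) iv by (metis inv_solve_left' m_assoc m_closed)
    have "has_klein G" unfolding has_klein_def using cz cu n c(1) z u ne by metis
    with nk show False ..
  qed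
  then have "unique_involution G z" unfolding unique_involution_def using z by blast
  then show ?thesis using that by blast
qed

text \<open>Conjugates of an involution are involutions.\<close>

lemma unique_involution_central:
  assumes z: "unique_involution G z" and g: "g \<in> carrier G"
  shows "z \<otimes> g = g \<otimes> z"
proof -
  have zc: "z \<in> carrier G" "z \<noteq> \<one>" "z \<otimes> z = \<one>" using z by (auto simp: unique_involution_def)
  let ?u = "inv g \<otimes> z \<otimes> g"
  have "?u \<otimes> ?u = inv g \<otimes> (z \<otimes> z) \<otimes> g"
    using zc(1) g by (simp add: m_assoc) (simp flip: m_assoc[of g "inv g"])
  then have "?u \<otimes> ?u = \<one>" using zc g by simp
  then have "?u = \<one> \<or> ?u = z" using z zc g by (auto simp: unique_involution_def)
  moreover have "?u \<noteq> \<one>"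
  proof
    assume "?u = \<one>"
    then have "g \<otimes> ?u \<otimes> inv g = \<one>" using g by simp
    moreover have "g \<otimes> ?u \<otimes> inv g = z" using g zc(1) by (simp add: m_assoc) (simp flip: m_assoc)
    ultimately show False using zc by simp
  qed
  ultimately have "g \<otimes> (inv g \<otimes> z \<otimes> g) = g \<otimes> z" by simp
  then show ?thesis using g zc(1) by (simp flip: m_assoc)
qed

lemma index_two_of_card:
  assumes H: "subgroup H G" and c: "2 * card H = card (carrier G)"
  shows "index_two G H"
proof -
  have "H \<noteq> carrier G" using c card_carrier by auto
  then obtain M where M: "index_two G M" "H \<subseteq> M" using in_index_two[OF H] by metis
  have "card H = card M" using index_two_card[OF fin M(1)] c by simp
  moreover have "finite M" using M(1) fin by (auto simp: index_two_def dest: subgroup.subset finite_subset)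
  ultimately show ?thesis using M card_subset_eq by metis
qed

text \<open>With \<open>y\<close> also every \<open>y \<otimes> x [^] i\<close> lies outside the
  cyclic group and so does not square to one. Hence \<open>N div 2 + (c + 1) * i\<close> is never
  divisible by \<open>N\<close>, which for these small \<open>N\<close> leaves only the inverting
  action.\<close>

lemma quaternion_of_index_two:
  assumes N: "N = 4 \<or> N = 8" and o: "order G = 2 * N"
    and x: "x \<in> carrier G" "ord x = N"
    and sq: "\<And>y. y \<in> carrier G \<Longrightarrow> y \<notin> generate G {x} \<Longrightarrow> y \<otimes> y = x [^] (N div 2)"
  shows "\<exists>y. metacyclic G N (N div 2) (N - 1) x y"
proof -
  have A: "index_two G (generate G {x})"
    using generate_pow_card[OF x(1)] x o by (intro index_two_of_card generate_singleton_subgroup) (auto simp: order_def)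
  then obtain y where y: "y \<in> carrier G" "y \<notin> generate G {x}"
    using subgroup.subset[OF generate_singleton_subgroup[OF x(1)]] by (auto simp: index_two_def)
  obtain c where c: "c < N" "x \<otimes> y = y \<otimes> x [^] c"
    using cyclic_index_two_action[OF A x _ y(1)] N by (metis zero_less_numeral)
  have x1: "x [^] N = \<one>" using pow_ord_eq_1[OF x(1)] x(2) by simp
  have h: "x [^] (N div 2) \<noteq> \<one>" using pow_eq_id[OF x(1), of "N div 2"] x(2) N by auto
  have sqn: "x [^] (N div 2 + (c + 1) * i) \<noteq> \<one>" for i :: nat
  proof -
    have "x [^] i \<in> generate G {x}" using generate_pow_nat[OF x(1)] x N by auto
    then have "y \<otimes> x [^] i \<notin> generate G {x}" using A y x(1) by (auto simp: index_two_def)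
    then have "(y \<otimes> x [^] i) \<otimes> (y \<otimes> x [^] i) = x [^] (N div 2)" using sq y(1) x(1) by simp
    then show ?thesis using square_swap[OF x(1) y(1) c(2) sq[OF y]] h by simp
  qed
  \<comment> \<open>An even exponent would send \<open>x [^] (N div 2)\<close> to the identity under
    conjugation by \<open>y\<close>.\<close>
  have "odd c"
  proof
    assume "even c"
    then have "N dvd c * (N div 2)" using N by auto
    then have "x [^] (c * (N div 2)) = \<one>" using pow_eq_id[OF x(1)] x(2) by simp
    then have "x [^] (N div 2) \<otimes> y = y"
      using pow_swap[OF x(1) y(1) c(2), of "N div 2"] y(1) by simp
    then show False using h r_cancel_one[OF y(1) nat_pow_closed[OF x(1)]] by simp
  qed
  have nd: "\<not> N dvd N div 2 + (c + 1) * i" for i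
    using sqn[of i] pow_eq_id[OF x(1), of "N div 2 + (c + 1) * i"] x(2) by metis
  \<comment> \<open>For \<open>N = 4\<close>, \<open>i = 1\<close> excludes 1; for
    \<open>N = 8\<close>, \<open>i = 1\<close> excludes 3 and \<open>i = 2\<close> excludes 1 and
    5.\<close>
  have "c = N - 1"
    using N
  proof
    assume "N = 4"
    then have "c = 1 \<or> c = 3" using c(1) \<open>odd c\<close> by presburger
    then show ?thesis using nd[of 1] \<open>N = 4\<close> by (elim disjE) (simp_all del: One_nat_def)
  next
    assume "N = 8"
    then have "c = 1 \<or> c = 3 \<or> c = 5 \<or> c = 7" using c(1) \<open>odd c\<close> by presburger
    then show ?thesis using nd[of 1] nd[of 2] \<open>N = 8\<close> by (elim disjE) (simp_all del: One_nat_def)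
  qed
  then show ?thesis using metacyclic_index_two[OF A x(1) x1 y sq[OF y]] c(2) by auto
qed

text \<open>The order is a power of two below eight, and orders one and two are taken by the
  identity and \<open>z\<close>. The square is then an involution, so it is
  \<open>z\<close>.\<close>

lemma ord_eq_4:
  assumes z: "unique_involution G z" and x: "x \<in> carrier G" "x \<noteq> \<one>" "x \<noteq> z" and o: "\<not> 8 dvd ord x"
  shows "ord x = 4" "x \<otimes> x = z"
proof -
  have zc: "z \<in> carrier G" "z \<noteq> \<one>" "z \<otimes> z = \<one>"
    "\<And>u. u \<in> carrier G \<Longrightarrow> u \<otimes> u = \<one> \<Longrightarrow> u = \<one> \<or> u = z"
    using z by (auto simp: unique_involution_def)
  obtain m where m: "ord x = 2 ^ m" using ord_two_power[OF x(1)] by metis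
  have "\<not> 3 \<le> m" using o m le_imp_power_dvd[of 3 m "2::nat"] by auto
  moreover have xx: "x \<otimes> x \<noteq> \<one>" using zc(4)[OF x(1)] x by auto
  then have "\<not> ord x dvd 2" using pow_eq_id[OF x(1), of 2] x(1) by (simp add: numeral_2_eq_2)
  then have "m \<noteq> 0" "m \<noteq> 1" using m by (auto intro: ccontr simp del: neq0_conv)
  ultimately have "m = 2" by linarith
  then show o4: "ord x = 4" using m by simp
  have "(x \<otimes> x) \<otimes> (x \<otimes> x) = x [^] (4::nat)" using x(1) by (simp add: numeral_eq_Suc m_assoc)
  also have "\<dots> = \<one>" using pow_ord_eq_1[OF x(1)] o4 by simp
  finally show "x \<otimes> x = z" using zc(4)[of "x \<otimes> x"] xx x(1) by simp
qed

end

section \<open>Noncyclic groups of order 8 and 16 without a Klein four-group\<close>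

text \<open>A subgroup of order four contributes three subgroups, and three more lie outside it.
  Every element other than the identity and the involution \<open>z\<close> has order four and
  square \<open>z\<close>, which is the hypothesis of
  \<open>quaternion_of_index_two\<close>.\<close>

lemma order_8_no_klein:
  assumes "two_group G 3" and nc: "\<not> cyclic_group G" and nk: "\<not> has_klein G"
  shows "card (subgroups_of G) \<ge> 6" "\<exists>a b. metacyclic G 4 2 3 a b"
proof -
  interpret two_group G 3 by fact
  obtain M where M: "index_two G M" using exists_index_two by auto
  have "2 + 1 \<le> card (subgroups_of (G\<lparr>carrier := M\<rparr>))"
    using two_group_index_two(1)[OF M] by (intro card_subgroups_ge_Suc) simp
  then show "card (subgroups_of G) \<ge> 6" using card_subgroups_index_two_ge[OF nc M] by simp
  obtain z where z: "unique_involution G z" using unique_involution_exists[OF _ nk] by auto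
  have n8: "\<not> 8 dvd ord x" if "x \<in> carrier G" for x
  proof
    assume "8 dvd ord x"
    then have "card (generate G {x}) = card (carrier G)"
      using ord_dvd_group_order[OF that] card_carrier generate_pow_card[OF that] order_two_power by (simp add: dvd_antisym)
    then have "generate G {x} = carrier G"
      using card_subset_eq[OF fin subgroup.subset[OF generate_singleton_subgroup[OF that]]] by simp
    then show False using nc that cyclic_iff by blast
  qed
  have "\<not> carrier G \<subseteq> {\<one>\<^bsub>G\<^esub>, z}"
  proof
    assume "carrier G \<subseteq> {\<one>\<^bsub>G\<^esub>, z}"
    then have "card (carrier G) \<le> card {\<one>\<^bsub>G\<^esub>, z}" by (intro card_mono) auto
    also have "\<dots> \<le> 2" by (simp add: card_insert_if)
    finally show False using card_carrier by simp
  qed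
  then obtain x where x: "x \<in> carrier G" "x \<noteq> \<one>\<^bsub>G\<^esub>" "x \<noteq> z" by blast
  have ox: "ord x = 4" "x \<otimes>\<^bsub>G\<^esub> x = z" using ord_eq_4[OF z x n8[OF x(1)]] by auto
  have "y \<otimes>\<^bsub>G\<^esub> y = x [^]\<^bsub>G\<^esub> (4 div 2 :: nat)" if y: "y \<in> carrier G" "y \<notin> generate G {x}" for y
  proof -
    have "x \<in> generate G {x}" by (simp add: generate.incl)
    then have "z \<in> generate G {x}" using ox(2) generate.eng by metis
    then have "y \<noteq> \<one>\<^bsub>G\<^esub>" "y \<noteq> z" using y generate.one by metis+
    then have "y \<otimes>\<^bsub>G\<^esub> y = z" using ord_eq_4[OF z y(1) _ _ n8[OF y(1)]] by auto
    moreover have "x [^]\<^bsub>G\<^esub> (2 :: nat) = z" using ox(2) x(1) by (simp add: numeral_2_eq_2)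
    moreover have "4 div 2 = (2 :: nat)" by simp
    ultimately show ?thesis by metis
  qed
  then show "\<exists>a b. metacyclic G 4 2 3 a b"
    using quaternion_of_index_two[of 4 x] x(1) ox(1) order_two_power by auto
qed

context two_group
begin

text \<open>If every square lies in \<open>{1, z}\<close> with \<open>z\<close> the only involution, then centralizers of elements
  outside \<open>{1, z}\<close> have at most four elements, while commutators lie in \<open>{1, z}\<close>, so that
  centralizers have index at most two.\<close>

lemma elementary_mod_center_card_le:
  assumes z: "unique_involution G z" and sq: "\<And>x. x \<in> carrier G \<Longrightarrow> x \<otimes> x = \<one> \<or> x \<otimes> x = z"
    and g: "g \<in> carrier G" "g \<noteq> \<one>" "g \<noteq> z"
  shows "card (carrier G) \<le> 8"
proof -
  have zc: "z \<in> carrier G" "z \<otimes> z = \<one>"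
    "\<And>u. u \<in> carrier G \<Longrightarrow> u \<otimes> u = \<one> \<Longrightarrow> u = \<one> \<or> u = z"
    using z by (auto simp: unique_involution_def)
  note cen = unique_involution_central[OF z]
  let ?Z = "{\<one>, z}"
  have inv_eq: "\<exists>e\<in>?Z. inv u = u \<otimes> e" if u: "u \<in> carrier G" for u
  proof -
    have "u \<otimes> u = \<one> \<or> u \<otimes> (u \<otimes> z) = \<one>" using sq[OF u] zc u by (auto simp flip: m_assoc)
    then have "inv u = u \<or> inv u = u \<otimes> z" using u zc(1) by (metis inv_comm inv_equality m_closed)
    then show ?thesis using u by auto
  qed
  have comm: "g \<otimes> u = u \<otimes> g \<or> g \<otimes> u = u \<otimes> g \<otimes> z" if u: "u \<in> carrier G" for u
  proof -
    \<comment> \<open>Inversion changes an element only by a factor in the central set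
      \<open>?Z\<close>. Comparing \<open>inv (g \<otimes> u)\<close> with
      \<open>inv u \<otimes> inv g\<close> therefore shows that \<open>g\<close> and
      \<open>u\<close> commute up to such a factor.\<close>
    obtain d where d: "d \<in> ?Z" "inv (g \<otimes> u) = g \<otimes> u \<otimes> d" using inv_eq[OF m_closed[OF g(1) u]] by blast
    obtain e where e: "e \<in> ?Z" "inv g = g \<otimes> e" using inv_eq[OF g(1)] by blast
    obtain f where f: "f \<in> ?Z" "inv u = u \<otimes> f" using inv_eq[OF u] by blast
    have Z: "d \<in> carrier G" "e \<in> carrier G" "f \<in> carrier G" using d e f zc by auto
    have ce: "e \<otimes> w = w \<otimes> e" if "w \<in> carrier G" for w using e(1) cen[OF that] that by auto
    have "g \<otimes> u \<otimes> d = inv u \<otimes> inv g" using d(2) g u by (simp add: inv_mult_group)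
    also have "\<dots> = u \<otimes> g \<otimes> (f \<otimes> e)"
    proof -
      have cf: "f \<otimes> w = w \<otimes> f" if "w \<in> carrier G" for w using f(1) cen[OF that] that by auto
      have "u \<otimes> f \<otimes> (g \<otimes> e) = u \<otimes> (f \<otimes> g) \<otimes> e" using u g Z by (simp add: m_assoc)
      also have "\<dots> = u \<otimes> g \<otimes> (f \<otimes> e)" unfolding cf[OF g(1)] using u g Z by (simp add: m_assoc)
      finally show ?thesis using e(2) f(2) by simp
    qed
    finally have "g \<otimes> u \<otimes> (d \<otimes> d) = u \<otimes> g \<otimes> (f \<otimes> e \<otimes> d)"
      using u g Z by (simp flip: m_assoc)
    moreover have "d \<otimes> d = \<one>" using d(1) zc by auto
    moreover have "f \<otimes> e \<otimes> d = \<one> \<or> f \<otimes> e \<otimes> d = z" using d(1) e(1) f(1) zc by (auto simp: m_assoc)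
    ultimately show ?thesis using u g by auto
  qed
  let ?C = "{u \<in> carrier G. g \<otimes> u = u \<otimes> g}"
  \<comment> \<open>If \<open>u\<close> differs from the identity and \<open>z\<close>, then
    \<open>g\<close> and \<open>u\<close> commute and both square to \<open>z\<close>; so
    \<open>g \<otimes> u\<close> squares to one and is itself the identity or
    \<open>z\<close>.\<close>
  have "?C \<subseteq> {\<one>, z, inv g, inv g \<otimes> z}"
  proof
    fix u assume "u \<in> ?C"
    then have u: "u \<in> carrier G" "g \<otimes> u = u \<otimes> g" by auto
    show "u \<in> {\<one>, z, inv g, inv g \<otimes> z}"
    proof (cases "u = \<one> \<or> u = z")
      case False
      have "g \<otimes> g = z" "u \<otimes> u = z" using sq[OF g(1)] sq[OF u(1)] zc(3)[OF g(1)] zc(3)[OF u(1)] False g by auto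
      moreover have "(g \<otimes> u) \<otimes> (g \<otimes> u) = (g \<otimes> g) \<otimes> (u \<otimes> u)"
        using g u by (metis m_assoc m_closed)
      ultimately have "(g \<otimes> u) \<otimes> (g \<otimes> u) = \<one>" using zc by simp
      then have "g \<otimes> u = \<one> \<or> g \<otimes> u = z" using zc(3) g u by simp
      moreover have "u = inv g \<otimes> (g \<otimes> u)" using g(1) u(1) by (simp flip: m_assoc)
      ultimately have "u = inv g \<or> u = inv g \<otimes> z" using g(1) by (metis inv_closed r_one)
      then show ?thesis by blast
    qed auto
  qed
  then have "card ?C \<le> card {\<one>, z, inv g, inv g \<otimes> z}" by (rule card_mono[rotated]) simp
  also have "\<dots> \<le> 4" by (simp add: card_insert_if)
  finally have C4: "card ?C \<le> 4" .
  have finC: "finite ?C" using fin by simp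
  show ?thesis
  proof (cases "carrier G \<subseteq> ?C")
    case True
    then have "card (carrier G) \<le> card ?C" using finC by (rule card_mono[rotated])
    then show ?thesis using C4 by linarith
  next
    case False
    then obtain h where h: "h \<in> carrier G" "g \<otimes> h \<noteq> h \<otimes> g" by blast
    then have gh: "g \<otimes> h = h \<otimes> g \<otimes> z" using comm by blast
    \<comment> \<open>If neither \<open>w\<close> nor \<open>h\<close> commutes with
      \<open>g\<close>, the two factors \<open>z\<close> cancel and \<open>w \<otimes> h\<close>
      commutes with \<open>g\<close>. So the complement of \<open>?C\<close> lies in one translate
      of it.\<close>
    have "carrier G \<subseteq> ?C \<union> (\<lambda>c. c \<otimes> inv h) ` ?C" (is "_ \<subseteq> _ \<union> ?D")
    proof
      fix w assume w: "w \<in> carrier G"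
      show "w \<in> ?C \<union> ?D"
      proof (cases "g \<otimes> w = w \<otimes> g")
        case False
        then have gw: "g \<otimes> w = w \<otimes> g \<otimes> z" using comm[OF w] by blast
        have "g \<otimes> (w \<otimes> h) = (g \<otimes> w) \<otimes> h" using g w h by (simp add: m_assoc)
        also have "\<dots> = w \<otimes> g \<otimes> (z \<otimes> h)" unfolding gw using g w h zc by (simp add: m_assoc)
        also have "\<dots> = w \<otimes> (g \<otimes> h) \<otimes> z" unfolding cen[OF h(1)] using g w h zc by (simp add: m_assoc)
        also have "\<dots> = (w \<otimes> h) \<otimes> g \<otimes> (z \<otimes> z)" unfolding gh using g w h zc(1) by (simp add: m_assoc)
        finally have "w \<otimes> h \<in> ?C" using g w h zc by simp
        moreover have "w = (w \<otimes> h) \<otimes> inv h" using w h by (simp add: m_assoc)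
        ultimately show ?thesis by (intro UnI2) (rule image_eqI)
      qed (use w in simp)
    qed
    then have "card (carrier G) \<le> card (?C \<union> ?D)" using finC by (intro card_mono) auto
    also have "\<dots> \<le> card ?C + card ?D" by (rule card_Un_le)
    also have "\<dots> \<le> card ?C + card ?C" using card_image_le[OF finC] by (rule add_left_mono)
    finally show ?thesis using C4 by linarith
  qed
qed

text \<open>The count is 4 + 3 + 4. A chain inside \<open>A\<close> gives four subgroups; the whole
  group, \<open>M1\<close> and \<open>M2\<close> give three of order 16 or 8. Each of the eight
  elements outside \<open>A\<close> generates a group of order four, and such a group has at most
  two elements outside \<open>A\<close>, since the square of a generator is in
  \<open>A\<close>.\<close>

lemma card_subgroups_outside_index_two:
  assumes nc: "\<not> cyclic_group G" and l: "l = 4" and A: "index_two G A"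
    and o: "\<And>y. y \<in> carrier G \<Longrightarrow> y \<notin> A \<Longrightarrow> ord y = 4"
  shows "card (subgroups_of G) \<ge> 11"
proof -
  obtain M1 M2 where M12: "index_two G M1" "index_two G M2" "M1 \<noteq> A" "M2 \<noteq> A" "M1 \<noteq> M2"
    "\<not> M1 \<subseteq> A" "\<not> M2 \<subseteq> A" "M1 \<inter> M2 \<subseteq> A" using noncyclic_index_two[OF nc A] .
  have AS: "subgroup A G" and sub: "subgroup M1 G" "subgroup M2 G" "M1 \<noteq> carrier G" "M2 \<noteq> carrier G"
    using A M12 by (auto simp: index_two_def)
  have AG: "A \<subseteq> carrier G" using AS by (rule subgroup.subset)
  define R where "R = subgroups_of (G\<lparr>carrier := A\<rparr>)"
  define B where "B = {carrier G, M1, M2}"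
  define Q where "Q = (\<lambda>y. generate G {y}) ` (carrier G - A)"
  have finS: "finite (subgroups_of G)" using finite_subgroups_of[OF fin] .
  have R: "K \<in> R \<longleftrightarrow> K \<in> subgroups_of G \<and> K \<subseteq> A" for K
    by (simp add: R_def subgroups_of_subgroup[OF AS])
  have Qn: "card K = 4" "\<not> K \<subseteq> A" "K \<in> subgroups_of G" if "K \<in> Q" for K
  proof -
    obtain y where "y \<in> carrier G - A" and yK: "K = generate G {y}" using \<open>K \<in> Q\<close> unfolding Q_def by (rule imageE)
    then have y: "y \<in> carrier G" "y \<notin> A" by auto
    note y = y yK
    show "card K = 4" using generate_pow_card[OF y(1)] o y by simp
    have "y \<in> K" unfolding y(3) by (simp add: generate.incl)
    then show "\<not> K \<subseteq> A" using y(2) by blast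
    show "K \<in> subgroups_of G" unfolding y(3) subgroups_of_def using generate_singleton_subgroup[OF y(1)] by simp
  qed
  have cB: "card K \<noteq> 4" if "K \<in> B" for K
  proof -
    have "K = carrier G \<or> K = M1 \<or> K = M2" using that unfolding B_def by blast
    then have "card K = 2 ^ l \<or> card K = 2 ^ (l - 1)"
      using two_group_index_two(3)[OF M12(1)] two_group_index_two(3)[OF M12(2)] card_carrier by metis
    then show ?thesis using l by auto
  qed
  have "\<not> carrier G \<subseteq> A" using M12(6) subgroup.subset[OF sub(1)] by blast
  then have BA: "\<not> K \<subseteq> A" if "K \<in> B" for K
    using that M12(6,7) unfolding B_def by blast
  have BS: "B \<subseteq> subgroups_of G" using sub subgroup_self by (simp add: B_def subgroups_of_def)
  have cB3: "card B = 3" unfolding B_def using M12(5) sub(3,4) by simp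
  have d1: "R \<inter> B = {}" using R BA by blast
  have d2: "(R \<union> B) \<inter> Q = {}" using R Qn cB by blast
  have S: "R \<union> B \<union> Q \<subseteq> subgroups_of G" using R BS Qn by blast
  have finR: "finite R" "finite B" "finite Q" using finite_subset[OF S finS] by auto
  have "card (R \<union> B \<union> Q) = card R + 3 + card Q"
    using card_Un_disjoint[OF _ _ d2] card_Un_disjoint[OF _ _ d1] finR cB3 by simp
  then have "card R + 3 + card Q \<le> card (subgroups_of G)" using card_mono[OF finS S] by simp
  moreover have "3 + 1 \<le> card R"
    unfolding R_def using two_group_index_two(1)[OF A] l by (intro card_subgroups_ge_Suc) simp
  moreover have "card Q \<ge> 4"
  proof -
    have K2: "card (K - A) \<le> 2" if "K \<in> Q" for K
    proof -
      obtain y where "y \<in> carrier G - A" and yK: "K = generate G {y}" using \<open>K \<in> Q\<close> unfolding Q_def by (rule imageE)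
    then have y: "y \<in> carrier G" "y \<notin> A" by auto
    note y = y yK
      have yy: "y \<otimes> y \<in> A" using A y by (auto simp: index_two_def)
      have "K - A \<subseteq> {y, y \<otimes> (y \<otimes> y)}"
      proof
        fix u assume u: "u \<in> K - A"
        then obtain i :: nat where "u = y [^] i" using generate_pow_nat[OF y(1)] o y by auto
        then have i: "u = y [^] (i mod 4)" using pow_mod[OF y(1), of 4 i] pow_ord_eq_1[OF y(1)] o y by simp
        have "i mod 4 \<noteq> 0" using u i subgroup.one_closed[OF AS] by (metis DiffD2 nat_pow_0)
        moreover have "y [^] (2::nat) = y \<otimes> y" using y(1) by (simp add: numeral_2_eq_2)
        then have "i mod 4 \<noteq> 2" using u i yy by (metis DiffD2)
        moreover have "i mod 4 < 4" by simp
        ultimately have "i mod 4 = 1 \<or> i mod 4 = 3" by linarith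
        moreover have "y [^] (1::nat) = y" "y [^] (3::nat) = y \<otimes> (y \<otimes> y)"
          using y(1) by (simp_all add: numeral_3_eq_3 m_assoc)
        ultimately show "u \<in> {y, y \<otimes> (y \<otimes> y)}" using i by auto
      qed
      then have "card (K - A) \<le> card {y, y \<otimes> (y \<otimes> y)}" by (rule card_mono[rotated]) simp
      also have "\<dots> \<le> 2" by (simp add: card_insert_if)
      finally show ?thesis .
    qed
    have "carrier G - A \<subseteq> (\<Union>K\<in>Q. K - A)"
    proof
      fix y assume y: "y \<in> carrier G - A"
      then have "generate G {y} \<in> Q" by (simp add: Q_def)
      moreover have "y \<in> generate G {y}" by (simp add: generate.incl)
      ultimately show "y \<in> (\<Union>K\<in>Q. K - A)" using y by blast
    qed
    moreover have finK: "finite K" if "K \<in> Q" for K using Qn(1)[OF that] by (metis card.infinite zero_neq_numeral)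
    ultimately have "card (carrier G - A) \<le> card (\<Union>K\<in>Q. K - A)" using finR(3) by (intro card_mono) auto
    also have "\<dots> \<le> (\<Sum>K\<in>Q. card (K - A))" using finR(3) by (rule card_UN_le)
    also have "\<dots> \<le> (\<Sum>K\<in>Q. 2)" using K2 by (rule sum_mono)
    finally have "card (carrier G - A) \<le> 2 * card Q" by simp
    moreover have "card (carrier G - A) = 8"
      using card_Diff_subset[OF finite_subset[OF AG fin] AG] two_group_index_two(3)[OF A] card_carrier l by simp
    ultimately show ?thesis by simp
  qed
  ultimately show ?thesis by linarith
qed

end

text \<open>Without an element of order eight all squares would lie in \<open>{1, z}\<close>, which
  is impossible beyond order eight. With \<open>x\<close> of order eight, a further element of order
  eight outside its cyclic group would produce two cyclic subgroups of index two and hence a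
  four-group. So all elements outside have order four and square \<open>z\<close>.\<close>

lemma order_16_no_klein:
  assumes "two_group G 4" and nc: "\<not> cyclic_group G" and nk: "\<not> has_klein G"
  shows "card (subgroups_of G) \<ge> 11" "\<exists>a b. metacyclic G 8 4 7 a b"
proof -
  interpret two_group G 4 by fact
  obtain z where z: "unique_involution G z" using unique_involution_exists[OF _ nk] by auto
  have n16: "ord x \<noteq> 16" if "x \<in> carrier G" for x
  proof
    assume "ord x = 16"
    then have "card (generate G {x}) = card (carrier G)"
      using card_carrier generate_pow_card[OF that] by simp
    then have "generate G {x} = carrier G"
      using card_subset_eq[OF fin subgroup.subset[OF generate_singleton_subgroup[OF that]]] by simp
    then show False using nc that cyclic_iff by blast
  qed
  have "\<not> carrier G \<subseteq> {\<one>\<^bsub>G\<^esub>, z}"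
  proof
    assume "carrier G \<subseteq> {\<one>\<^bsub>G\<^esub>, z}"
    then have "card (carrier G) \<le> card {\<one>\<^bsub>G\<^esub>, z}" by (intro card_mono) auto
    also have "\<dots> \<le> 2" by (simp add: card_insert_if)
    finally show False using card_carrier by simp
  qed
  then obtain g where g: "g \<in> carrier G" "g \<noteq> \<one>\<^bsub>G\<^esub>" "g \<noteq> z" by blast
  have "\<exists>x\<in>carrier G. ord x = 8"
  proof (rule ccontr)
    assume no: "\<not> (\<exists>x\<in>carrier G. ord x = 8)"
    have n8: "\<not> 8 dvd ord x" if x: "x \<in> carrier G" for x
    proof
      assume "8 dvd ord x"
      moreover obtain m where m: "m \<le> 4" "ord x = 2 ^ m" using ord_two_power[OF x] .
      ultimately have "(2::nat) ^ 3 dvd 2 ^ m" by simp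
      then have "3 \<le> m" by (rule power_dvd_imp_le) simp
      then have "m = 3 \<or> m = 4" using m(1) by linarith
      then show False using no n16 x m(2) by auto
    qed
    have "x \<otimes>\<^bsub>G\<^esub> x = \<one>\<^bsub>G\<^esub> \<or> x \<otimes>\<^bsub>G\<^esub> x = z" if x: "x \<in> carrier G" for x
    proof (cases "x = \<one>\<^bsub>G\<^esub> \<or> x = z")
      case True then show ?thesis using z by (auto simp: unique_involution_def)
    next
      case False then show ?thesis using ord_eq_4(2)[OF z x _ _ n8[OF x]] by simp
    qed
    then have "card (carrier G) \<le> 8" using elementary_mod_center_card_le[OF z _ g] by blast
    then show False using card_carrier by simp
  qed
  then obtain x where x: "x \<in> carrier G" "ord x = 8" by blast
  have A: "index_two G (generate G {x})"
    using generate_pow_card[OF x(1)] x card_carrier by (intro index_two_of_card generate_singleton_subgroup) simp_all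
  have x4: "x [^]\<^bsub>G\<^esub> (4::nat) = z"
  proof -
    have "x [^]\<^bsub>G\<^esub> (4::nat) \<otimes>\<^bsub>G\<^esub> x [^]\<^bsub>G\<^esub> (4::nat) = \<one>\<^bsub>G\<^esub>" "x [^]\<^bsub>G\<^esub> (4::nat) \<noteq> \<one>\<^bsub>G\<^esub>"
      using pow_eq_id[OF x(1)] x by (simp_all add: nat_pow_mult)
    then show ?thesis using z x(1) by (auto simp: unique_involution_def)
  qed
  have zA: "z \<in> generate G {x}" using x4 generate_pow_nat[OF x(1)] x(2) by auto
  have out: "ord y = 4 \<and> y \<otimes>\<^bsub>G\<^esub> y = z" if y: "y \<in> carrier G" "y \<notin> generate G {x}" for y
  proof -
    have "y \<noteq> \<one>\<^bsub>G\<^esub>" "y \<noteq> z" using y zA generate.one by metis+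
    moreover have "\<not> 8 dvd ord y"
    proof
      assume "8 dvd ord y"
      moreover obtain m where m: "m \<le> 4" "ord y = 2 ^ m" using ord_two_power[OF y(1)] .
      ultimately have "(2::nat) ^ 3 dvd 2 ^ m" by simp
      then have "3 \<le> m" by (rule power_dvd_imp_le) simp
      then have "m = 3" using m n16[OF y(1)] by (cases "m = 4") auto
      then have "index_two G (generate G {y})"
        using generate_pow_card[OF y(1)] m card_carrier by (intro index_two_of_card generate_singleton_subgroup y(1)) simp_all
      moreover have "generate G {x} \<noteq> generate G {y}" using y(2) generate.incl[of y "{y}" G] by blast
      ultimately obtain a b where "metacyclic G (2 ^ (4 - 1)) 0 1 a b \<or> metacyclic G (2 ^ (4 - 1)) 0 (1 + 2 ^ (4 - 2)) a b"
        using two_cyclic_metacyclic[OF _ x(1) A y(1)] by auto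
      then have "has_klein G" using split_metacyclic_has_klein by auto
      with nk show False ..
    qed
    ultimately show ?thesis using ord_eq_4[OF z y(1)] by blast
  qed
  show "card (subgroups_of G) \<ge> 11"
    using card_subgroups_outside_index_two[OF nc _ A] out by blast
  have "4 = 8 div (2::nat)" by simp
  then have "y \<otimes>\<^bsub>G\<^esub> y = x [^]\<^bsub>G\<^esub> (8 div 2 :: nat)" if "y \<in> carrier G" "y \<notin> generate G {x}" for y
    using out[OF that] x4 by metis
  then show "\<exists>a b. metacyclic G 8 4 7 a b"
    using quaternion_of_index_two[of 8 x] x order_two_power by auto
qed

section \<open>Lower bound and equality case for order at least 16\<close>

text \<open>If two subgroups of index two are cyclic, the group contains a four-group, and a
  subgroup of index two above it is not cyclic. The quaternion group of order eight shows that
  \<open>l \<ge> 4\<close> is essential.\<close>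

lemma noncyclic_index_two_exists:
  assumes "two_group G l" and l: "l \<ge> 4" and nc: "\<not> cyclic_group G"
  obtains M where "index_two G M" "\<not> cyclic_group (G\<lparr>carrier := M\<rparr>)"
proof -
  interpret two_group G l by fact
  have l3: "l \<ge> 3" using l by simp
  obtain M where M: "index_two G M" using exists_index_two l by auto
  obtain M1 where M1: "index_two G M1" "M1 \<noteq> M" using noncyclic_index_two[OF nc M] by metis
  show ?thesis
  proof (cases "cyclic_group (G\<lparr>carrier := M\<rparr>) \<and> cyclic_group (G\<lparr>carrier := M1\<rparr>)")
    case True
    have S: "subgroup M G" "subgroup M1 G" using M M1 by (auto simp: index_two_def)
    obtain x y where xy: "x \<in> M" "generate G {x} = M" "y \<in> M1" "generate G {y} = M1"
      using True S cyclic_subgroup_iff by metis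
    have "x \<in> carrier G" "y \<in> carrier G" using xy S by (auto dest: subgroup.subset)
    then obtain a b where "metacyclic G (2 ^ (l - 1)) 0 1 a b \<or> metacyclic G (2 ^ (l - 1)) 0 (1 + 2 ^ (l - 2)) a b"
      using two_cyclic_metacyclic[OF l, of x y] M M1 xy by metis
    then have "has_klein G" using split_metacyclic_has_klein[OF l] by metis
    then obtain M' where M': "index_two G M'" "has_klein (G\<lparr>carrier := M'\<rparr>)"
      using klein_subgroup[OF assms(1) l3] by metis
    then have "\<not> cyclic_group (G\<lparr>carrier := M'\<rparr>)"
      using two_group.has_klein_not_cyclic[OF two_group_index_two(1)] by metis
    then show ?thesis using that M'(1) by metis
  qed (use that M M1 in metis)
qed

lemma card_subgroups_ge:
  "two_group G l \<Longrightarrow> l \<ge> 4 \<Longrightarrow> \<not> cyclic_group G \<Longrightarrow> card (subgroups_of G) \<ge> 3 * l - 1"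
proof (induction l arbitrary: G)
  case (Suc l)
  interpret two_group G "Suc l" by fact
  show ?case
  \<comment> \<open>Order 16 is the base of the induction; the step needs the noncyclic
    \<open>M\<close> to have order at least 16.\<close>
  proof (cases "l = 3")
    case True
    then have tg: "two_group G 4" using Suc.prems(1) by simp
    show ?thesis
    proof (cases "has_klein G")
      case True then show ?thesis using klein_card_subgroups[OF Suc.prems(1)] \<open>l = 3\<close> by simp
    next
      case False then show ?thesis using order_16_no_klein(1)[OF tg Suc.prems(3)] \<open>l = 3\<close> by simp
    qed
  next
    case False
    obtain M where M: "index_two G M" "\<not> cyclic_group (G\<lparr>carrier := M\<rparr>)"
      using noncyclic_index_two_exists[OF Suc.prems] .
    then have "3 * l - 1 \<le> card (subgroups_of (G\<lparr>carrier := M\<rparr>))"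
      using Suc False two_group_index_two(1)[OF M(1)] by simp
    then show ?thesis using card_subgroups_index_two_ge[OF Suc.prems(3) M(1)] Suc.prems(2) by simp
  qed
qed simp

text \<open>Equality together with the lower bound for \<open>M\<close> leaves exactly three
  subgroups outside \<open>M\<close>. The alternative in \<open>lk\<close> secures that lower bound
  when \<open>M\<close> has only order eight.\<close>

lemma card_subgroups_eq_imp_metacyclic:
  assumes "two_group G l" and l: "l \<ge> 4" and nc: "\<not> cyclic_group G"
    and lk: "l \<ge> 5 \<or> has_klein G" and eq: "card (subgroups_of G) = 3 * l - 1"
  shows "\<exists>a b. metacyclic G (2 ^ (l - 1)) 0 1 a b \<or> metacyclic G (2 ^ (l - 1)) 0 (1 + 2 ^ (l - 2)) a b"
proof -
  interpret two_group G l by fact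
  have l3: "l \<ge> 3" using l by simp
  obtain M where M: "index_two G M" "3 * (l - 1) - 1 \<le> card (subgroups_of (G\<lparr>carrier := M\<rparr>))"
  proof (cases "has_klein G")
    case True
    then obtain M where M: "index_two G M" "has_klein (G\<lparr>carrier := M\<rparr>)"
      using klein_subgroup[OF assms(1) l3] by metis
    then show ?thesis using klein_card_subgroups[OF two_group_index_two(1)[OF M(1)]] l that by simp
  next
    case False
    then have l5: "l \<ge> 5" using lk by simp
    obtain M where M: "index_two G M" "\<not> cyclic_group (G\<lparr>carrier := M\<rparr>)"
      using noncyclic_index_two_exists[OF assms(1) l nc] .
    then show ?thesis using card_subgroups_ge[OF two_group_index_two(1)[OF M(1)]] l5 that by simp
  qed
  have "card (subgroups_of G) = card (subgroups_of (G\<lparr>carrier := M\<rparr>)) + 3"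
    using card_subgroups_index_two_ge[OF nc M(1)] M(2) eq l by linarith
  then obtain x y where "x \<in> carrier G" "y \<in> carrier G" "index_two G (generate G {x})"
    "index_two G (generate G {y})" "generate G {x} \<noteq> generate G {y}"
    using card_subgroups_index_two_eq[OF nc M(1)] by metis
  then show ?thesis using two_cyclic_metacyclic[OF l] by metis
qed

section \<open>Upper bounds for the number of subgroups\<close>

context group
begin

text \<open>The exponents of powers of \<open>a\<close> in \<open>H\<close> are the multiples of the
  least positive one, which divides the order of \<open>a\<close>. Thus \<open>j\<close> encodes the
  intersection of \<open>H\<close> with the cyclic group, and \<open>j = n\<close> is the trivial
  intersection.\<close>

lemma subgroup_of_cyclic_two_power:
  assumes a: "a \<in> carrier G" "ord a = 2 ^ n" and H: "subgroup H G"
  shows "\<exists>j\<le>n. \<forall>i::nat. a [^] i \<in> H \<longleftrightarrow> 2 ^ j dvd i"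
proof -
  interpret H: subgroup H G by (rule H)
  define d where "d = (LEAST d::nat. 0 < d \<and> a [^] d \<in> H)"
  have "0 < (2::nat) ^ n \<and> a [^] (2 ^ n :: nat) \<in> H" using pow_ord_eq_1[OF a(1)] a(2) by simp
  then have d: "0 < d" "a [^] d \<in> H"
    using LeastI[of "\<lambda>d::nat. 0 < d \<and> a [^] d \<in> H" "2 ^ n"] by (simp_all add: d_def)
  have min: "d \<le> m" if "0 < m" "a [^] m \<in> H" for m :: nat
    unfolding d_def using that by (intro Least_le) simp
  have pw: "a [^] (d * q) \<in> H" for q :: nat
  proof (induction q)
    case (Suc q)
    have "a [^] (d * Suc q) = a [^] d \<otimes> a [^] (d * q)" using a(1) by (simp add: nat_pow_mult)
    then show ?case using Suc d(2) by simp
  qed simp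
  have iff: "a [^] i \<in> H \<longleftrightarrow> d dvd i" for i :: nat
  proof
    assume i: "a [^] i \<in> H"
    have "a [^] i = a [^] (d * (i div d)) \<otimes> a [^] (i mod d)" using a(1) by (simp only: nat_pow_mult mult_div_mod_eq)
    then have "a [^] (i mod d) = inv (a [^] (d * (i div d))) \<otimes> a [^] i"
      using a(1) by (simp add: inv_solve_left)
    then have "a [^] (i mod d) \<in> H" using i pw by simp
    then show "d dvd i" using min[of "i mod d"] d(1) by (meson mod_greater_zero_iff_not_dvd mod_less_divisor not_le)
  qed (auto simp: pw elim: dvdE)
  have "d dvd 2 ^ n" using iff[of "2 ^ n"] pow_ord_eq_1[OF a(1)] a(2) by simp
  then obtain j where "j \<le> n" "d = 2 ^ j" by (metis divides_primepow_nat two_is_prime_nat)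
  then show ?thesis using iff by blast
qed

text \<open>The term \<open>Suc n\<close> accounts for the subgroups of the cyclic group of
  \<open>a\<close>. Any other subgroup is fixed by \<open>j\<close> and by the residue
  \<open>i\<close> modulo \<open>2 ^ j\<close> with \<open>b \<otimes> a [^] i\<close> in it; the
  square of this element lies in the intersection, which is the divisibility condition.\<close>

lemma metacyclic_card_subgroups_le:
  assumes m: "metacyclic G (2 ^ n) t k a b" and o: "order G = 2 * 2 ^ n"
  shows "card (subgroups_of G) \<le> Suc n + (\<Sum>j\<le>n. card {i. i < 2 ^ j \<and> 2 ^ j dvd t + (k + 1) * i})"
proof -
  have ab: "a \<in> carrier G" "b \<in> carrier G" "b \<otimes> b = a [^] t" "a \<otimes> b = b \<otimes> a [^] k"
    using m by (auto simp: metacyclic_def)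
  have orda: "ord a = 2 ^ n" and bA: "b \<notin> generate G {a}" using metacyclic_ord[OF m _ o] by auto
  define D where "D j = (\<lambda>q::nat. a [^] (2 ^ j * q)) ` UNIV" for j :: nat
  define I where "I j = {i::nat. i < 2 ^ j \<and> 2 ^ j dvd t + (k + 1) * i}" for j :: nat
  let ?F = "\<lambda>(j, i). D j \<union> (\<lambda>u. b \<otimes> a [^] i \<otimes> u) ` D j"
  have "subgroups_of G \<subseteq> D ` {..n} \<union> ?F ` (SIGMA j:{..n}. I j)"
  proof
    fix H assume "H \<in> subgroups_of G"
    then have H: "subgroup H G" by (simp add: subgroups_of_def)
    interpret H: subgroup H G by (rule H)
    obtain j where j: "j \<le> n" and "\<forall>i::nat. a [^] i \<in> H \<longleftrightarrow> 2 ^ j dvd i"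
      using subgroup_of_cyclic_two_power[OF ab(1) orda H] by blast
    then have j2: "a [^] i \<in> H \<longleftrightarrow> 2 ^ j dvd i" for i :: nat by blast
    have "a [^] (2 ^ j * q) \<in> H" for q :: nat unfolding j2 by (rule dvd_triv_left)
    then have DH: "D j \<subseteq> H" unfolding D_def by blast
    have HD: "a [^] i \<in> D j" if hi: "a [^] i \<in> H" for i :: nat
    proof -
      obtain q where "i = 2 ^ j * q" using hi unfolding j2 dvd_def by blast
      then show ?thesis unfolding D_def by blast
    qed
    have N0: "0 < (2::nat) ^ n" by simp
    have elem: "\<exists>i::nat. x = a [^] i \<or> x = b \<otimes> a [^] i" if "x \<in> carrier G" for x
      using metacyclic_elem[OF m N0 that] by blast
    show "H \<in> D ` {..n} \<union> ?F ` (SIGMA j:{..n}. I j)"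
    proof (cases "\<exists>p::nat. b \<otimes> a [^] p \<in> H")
      case False
      have "H \<subseteq> D j"
      proof
        fix x assume "x \<in> H"
        then show "x \<in> D j" using elem[OF H.mem_carrier[OF \<open>x \<in> H\<close>]] False HD by metis
      qed
      then have "H = D j" using DH by blast
      then show ?thesis using j by blast
    next
      case True
      then obtain p :: nat where p: "b \<otimes> a [^] p \<in> H" by blast
      \<comment> \<open>Powers of \<open>a\<close> with exponent divisible by \<open>2 ^ j\<close>
        lie in \<open>H\<close>, so only the residue of \<open>p\<close> matters.\<close>
      define i where "i = p mod 2 ^ j"
      have "a [^] p = a [^] i \<otimes> a [^] (2 ^ j * (p div 2 ^ j))"
        using ab(1) by (simp add: nat_pow_mult i_def)
      then have "b \<otimes> a [^] i = b \<otimes> a [^] p \<otimes> inv (a [^] (2 ^ j * (p div 2 ^ j)))"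
        using ab by (simp add: m_assoc)
      then have bi: "b \<otimes> a [^] i \<in> H" using p j2 by simp
      then have "(b \<otimes> a [^] i) \<otimes> (b \<otimes> a [^] i) \<in> H" by simp
      then have "2 ^ j dvd t + (k + 1) * i" using square_swap[OF ab(1,2,4,3)] j2 by simp
      then have iI: "i \<in> I j" by (simp add: I_def i_def)
      have "H \<subseteq> ?F (j, i)"
      proof
        fix x assume x: "x \<in> H"
        then obtain r :: nat where r: "x = a [^] r \<or> x = b \<otimes> a [^] r" using elem[OF H.mem_carrier[OF x]] by blast
        show "x \<in> ?F (j, i)"
        proof (cases "x = a [^] r")
          case True then show ?thesis using HD x by simp
        next
          case False
          then have xr: "x = b \<otimes> a [^] r" using r by simp
          \<comment> \<open>With natural exponents \<open>i * (2 ^ n - 1)\<close> stands for -i, so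
            \<open>?u\<close> is the power of \<open>a\<close> with exponent r - i.\<close>
          let ?u = "a [^] (r + i * (2 ^ n - 1))"
          have "i + i * (2 ^ n - 1) = 2 ^ n * i" by (cases "(2::nat) ^ n") auto
          then have "a [^] (i + i * (2 ^ n - 1)) = \<one>" using pow_eq_id[OF ab(1)] orda by simp
          then have "a [^] (i + (r + i * (2 ^ n - 1))) = a [^] r"
            using ab(1) by (metis add.left_commute nat_pow_closed nat_pow_mult r_one)
          then have xu: "x = b \<otimes> a [^] i \<otimes> ?u" using xr ab by (simp add: m_assoc nat_pow_mult)
          then have "inv (b \<otimes> a [^] i) \<otimes> x = ?u"
            using ab(1,2) by (simp flip: m_assoc[of "inv (b \<otimes> a [^] i)" "b \<otimes> a [^] i"])
          moreover have "inv (b \<otimes> a [^] i) \<otimes> x \<in> H" using bi x by simp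
          ultimately have "?u \<in> D j" using HD by simp
          then have "x \<in> (\<lambda>u. b \<otimes> a [^] i \<otimes> u) ` D j" using xu by (rule image_eqI[rotated])
          then show ?thesis by simp
        qed
      qed
      moreover have "?F (j, i) \<subseteq> H" using DH bi by auto
      ultimately have "H = ?F (j, i)" by (rule equalityI)
      moreover have "(j, i) \<in> (SIGMA j:{..n}. I j)" using j iI by simp
      ultimately show ?thesis by (intro UnI2) (rule image_eqI)
    qed
  qed
  moreover have finI: "finite (I j)" for j by (simp add: I_def)
  ultimately have "card (subgroups_of G) \<le> card (D ` {..n} \<union> ?F ` (SIGMA j:{..n}. I j))"
    by (intro card_mono) auto
  also have "\<dots> \<le> card (D ` {..n}) + card (?F ` (SIGMA j:{..n}. I j))" by (rule card_Un_le)
  also have "\<dots> \<le> card {..n} + card (SIGMA j:{..n}. I j)"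
    using finI by (intro add_mono card_image_le) auto
  also have "\<dots> = Suc n + (\<Sum>j\<le>n. card (I j))" using finI by simp
  finally show ?thesis by (simp add: I_def)
qed

text \<open>As \<open>c\<close> is odd, the condition on \<open>i\<close> becomes divisibility by
  half of \<open>2 ^ j\<close>: one solution for \<open>j = 0\<close>, at most two for each later
  \<open>j\<close>. The sum is (n + 1) + 1 + 2n, which is 3l - 1 for n = l - 1.\<close>

lemma split_metacyclic_card_subgroups_le:
  assumes m: "metacyclic G (2 ^ n) 0 k a b" and o: "order G = 2 * 2 ^ n" and k: "k + 1 = 2 * c" "odd c"
  shows "card (subgroups_of G) \<le> 3 * n + 2"
proof -
  have 0: "card {i::nat. i < 2 ^ 0 \<and> 2 ^ 0 dvd 0 + (k + 1) * i} = 1" by simp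
  have "card {i::nat. i < 2 ^ j \<and> 2 ^ j dvd 0 + (k + 1) * i} \<le> 2" if j0: "j \<noteq> 0" for j
  proof -
    obtain r where r: "j = Suc r" using j0 not0_implies_Suc by blast
    have "{i::nat. i < 2 ^ j \<and> 2 ^ j dvd 0 + (k + 1) * i} \<subseteq> {0, 2 ^ r}"
    proof
      fix i assume "i \<in> {i::nat. i < 2 ^ j \<and> 2 ^ j dvd 0 + (k + 1) * i}"
      then have i0: "i < 2 ^ j" "2 ^ j dvd (k + 1) * i" by simp_all
      have i: "i < 2 ^ r * 2" using i0(1) r by simp
      have "2 * 2 ^ r dvd 2 * (c * i)" using i0(2) unfolding r k(1) by (simp only: power_Suc mult.assoc)
      then have "2 ^ r dvd c * i" by (metis nat_mult_dvd_cancel1 zero_less_numeral)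
      moreover have "coprime (2 ^ r) c" using k(2) by simp
      ultimately have "2 ^ r dvd i" by (simp add: coprime_dvd_mult_right_iff)
      then obtain q where q: "i = 2 ^ r * q" by (auto elim: dvdE)
      then have "q < 2" using i by simp
      then have "q = 0 \<or> q = 1" by linarith
      then show "i \<in> {0, 2 ^ r}" using q by auto
    qed
    then have "card {i::nat. i < 2 ^ j \<and> 2 ^ j dvd 0 + (k + 1) * i} \<le> card {0, 2 ^ r :: nat}"
      by (rule card_mono[rotated]) simp
    also have "\<dots> \<le> 2" by (simp add: card_insert_if)
    finally show ?thesis .
  qed
  then have "(\<Sum>j\<in>{1..n}. card {i::nat. i < 2 ^ j \<and> 2 ^ j dvd 0 + (k + 1) * i}) \<le> (\<Sum>j\<in>{1..n}. 2)"
    by (intro sum_mono) auto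
  moreover have "{..n} = insert 0 {1..n}" by auto
  then have "(\<Sum>j\<le>n. card {i::nat. i < 2 ^ j \<and> 2 ^ j dvd 0 + (k + 1) * i})
    = card {i::nat. i < 2 ^ 0 \<and> 2 ^ 0 dvd 0 + (k + 1) * i} + (\<Sum>j\<in>{1..n}. card {i::nat. i < 2 ^ j \<and> 2 ^ j dvd 0 + (k + 1) * i})"
    by (simp only: sum.insert finite_atLeastAtMost) simp
  ultimately show ?thesis using metacyclic_card_subgroups_le[OF m o] unfolding 0 by simp
qed

text \<open>Here \<open>k + 1\<close> is \<open>2 ^ n\<close>, so \<open>i\<close> drops out of the
  condition: it fails for \<open>j = n\<close>, and for smaller \<open>j\<close> all
  \<open>2 ^ j\<close> residues may be counted. The values for n = 2 and n = 3 are 6 and 11.\<close>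

lemma quaternion_card_subgroups_le:
  assumes m: "metacyclic G (2 ^ n) (2 ^ (n - 1)) (2 ^ n - 1) a b" and o: "order G = 2 * 2 ^ n" and n: "n \<ge> 1"
  shows "card (subgroups_of G) \<le> n + 2 ^ n"
proof -
  obtain r where r: "n = Suc r" using n by (cases n) auto
  let ?I = "\<lambda>j. {i::nat. i < 2 ^ j \<and> 2 ^ j dvd 2 ^ (n - 1) + (2 ^ n - 1 + 1) * i}"
  have k: "2 ^ n - 1 + 1 = (2 :: nat) ^ n" by simp
  have "?I n = {}"
  proof -
    have "\<not> 2 ^ n dvd 2 ^ (n - 1) + 2 ^ n * i" for i :: nat
      using r by (auto simp: dvd_add_left_iff dest: dvd_imp_le)
    then show ?thesis unfolding k by simp
  qed
  then have "card (?I n) = 0" by simp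
  moreover have "card (?I j) \<le> 2 ^ j" for j
    using card_mono[of "{..<2 ^ j :: nat}" "?I j"] by auto
  then have "(\<Sum>j<n. card (?I j)) \<le> (\<Sum>j<n. 2 ^ j)" by (rule sum_mono)
  moreover have "(\<Sum>j<n. 2 ^ j) = (2::nat) ^ n - 1" by (rule sum_power2[unfolded lessThan_atLeast0[symmetric]])
  moreover have "(\<Sum>j\<le>n. card (?I j)) = (\<Sum>j<n. card (?I j)) + card (?I n)"
    by (simp flip: lessThan_Suc_atMost)
  ultimately have "(\<Sum>j\<le>n. card (?I j)) \<le> 2 ^ n - 1" by linarith
  then have "card (subgroups_of G) \<le> Suc n + (2 ^ n - 1)"
    using metacyclic_card_subgroups_le[OF m o] by linarith
  moreover have "(2::nat) ^ n \<ge> 1" by simp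
  ultimately show ?thesis by linarith
qed

end

section \<open>Presentations\<close>

definition eval_word :: "('a, 'b) monoid_scheme \<Rightarrow> ('x \<Rightarrow> 'a) \<Rightarrow> 'x gword \<Rightarrow> 'a" where
  "eval_word G \<rho> w = foldr (\<lambda>(x, e) g. (if e then \<rho> x else inv\<^bsub>G\<^esub> \<rho> x) \<otimes>\<^bsub>G\<^esub> g) w \<one>\<^bsub>G\<^esub>"

context group
begin

context
  fixes \<rho> :: "'x \<Rightarrow> 'a"
  assumes \<rho>: "\<And>x. \<rho> x \<in> carrier G"
begin

lemma eval_word_Nil: "eval_word G \<rho> [] = \<one>"
  by (simp add: eval_word_def)

lemma eval_word_Cons:
  "eval_word G \<rho> ((x, e) # w) = (if e then \<rho> x else inv \<rho> x) \<otimes> eval_word G \<rho> w"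
  by (simp add: eval_word_def)

lemma eval_word_closed: "eval_word G \<rho> w \<in> carrier G"
  by (induction w) (auto simp: eval_word_Nil eval_word_Cons \<rho>)

lemma eval_word_append: "eval_word G \<rho> (u @ v) = eval_word G \<rho> u \<otimes> eval_word G \<rho> v"
  by (induction u) (auto simp: eval_word_Nil eval_word_Cons \<rho> eval_word_closed m_assoc)

lemma eval_word_gen: "eval_word G \<rho> (wgen x) = \<rho> x"
  by (simp add: wgen_def eval_word_Cons eval_word_Nil \<rho>)

lemma eval_word_winv: "eval_word G \<rho> (winv w) = inv (eval_word G \<rho> w)"
proof (induction w)
  case (Cons p w)
  obtain x e where "p = (x, e)" by (cases p)
  moreover from this have "winv (p # w) = winv w @ [(x, \<not> e)]" by (simp add: winv_def)
  ultimately show ?case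
    using Cons by (simp add: eval_word_append eval_word_Cons eval_word_Nil inv_mult_group eval_word_closed \<rho>)
qed (simp add: winv_def eval_word_Nil)

lemma eval_word_wpow: "eval_word G \<rho> (wpow w n) = eval_word G \<rho> w [^] n"
proof (induction n)
  case (Suc n)
  have "wpow w (Suc n) = w @ wpow w n" by (simp add: wpow_def)
  then show ?case using Suc nat_pow_Suc2[OF eval_word_closed] by (simp add: eval_word_append)
qed (simp add: wpow_def eval_word_Nil)

text \<open>Evaluation respects the congruence once it respects the relations, so it is well defined
  on the presented group.\<close>

lemma eval_word_pres_eq:
  assumes R: "\<And>u v. (u, v) \<in> R \<Longrightarrow> eval_word G \<rho> u = eval_word G \<rho> v" and uv: "pres_eq R u v"
  shows "eval_word G \<rho> u = eval_word G \<rho> v"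
  using uv
proof (induction rule: pres_eq.induct)
  case (cancel x e)
  then show ?case by (cases e) (simp_all add: eval_word_Cons eval_word_Nil \<rho>)
qed (simp_all add: R eval_word_append)

lemma generate_eval_word:
  assumes "g \<in> generate G (range \<rho>)" shows "\<exists>w. g = eval_word G \<rho> w"
  using assms
proof (induction rule: generate.induct)
  case one then show ?case using eval_word_Nil by metis
next
  case (incl h) then show ?case using eval_word_gen by (metis imageE)
next
  case (inv h) then show ?case using eval_word_gen eval_word_winv by (metis imageE)
next
  case (eng h1 h2) then show ?case using eval_word_append by metis
qed

text \<open>Evaluation of words induces a homomorphism from the presented group onto
  \<open>G\<close>, and the order bound makes it injective. The group \<open>G\<close> thus serves
  as the model that rules out a collapse of the presentation.\<close>

lemma iso_presented_group:
  assumes R: "\<And>u v. (u, v) \<in> R \<Longrightarrow> eval_word G \<rho> u = eval_word G \<rho> v"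
    and gen: "generate G (range \<rho>) = carrier G"
    and fin: "finite (carrier (presented_group R))" and le: "order (presented_group R) \<le> order G"
  shows "G \<cong> presented_group R"
proof -
  let ?P = "presented_group R"
  interpret P: group ?P by (rule group_presented_group)
  define h where "h C = eval_word G \<rho> (SOME w. C = pres_class R w)" for C
  have h: "h (pres_class R w) = eval_word G \<rho> w" for w
  proof -
    have "pres_class R w = pres_class R (SOME w'. pres_class R w = pres_class R w')"
      by (rule someI) (rule HOL.refl)
    then show ?thesis
      unfolding h_def using eval_word_pres_eq[OF R] pres_class_eq_iff by metis
  qed
  have hom: "h \<in> hom ?P G"
    by (rule homI) (auto simp: presented_group_carrier presented_group_mult h eval_word_closed eval_word_append)
  have img: "h ` carrier ?P = carrier G"
  proof
    show "h ` carrier ?P \<subseteq> carrier G" using hom by (auto simp: hom_def)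
    show "carrier G \<subseteq> h ` carrier ?P"
    proof
      fix g assume "g \<in> carrier G"
      then obtain w where "g = eval_word G \<rho> w" using gen generate_eval_word by blast
      then show "g \<in> h ` carrier ?P" using h by (metis presented_group_carrier rangeI image_eqI)
    qed
  qed
  have "card (h ` carrier ?P) = card (carrier ?P)"
    using le img card_image_le[OF fin, of h] by (simp add: order_def)
  then have "inj_on h (carrier ?P)" using fin by (rule eq_card_imp_inj_on[rotated])
  then have "h \<in> iso ?P G" using hom img by (simp add: iso_def bij_betw_def)
  then show ?thesis using P.iso_sym by (auto simp: is_iso_def)
qed

end

end

lemma presented_group_pow:
  "pres_class R w [^]\<^bsub>presented_group R\<^esub> (n::nat) = pres_class R (wpow w n)"
proof (induction n)
  case 0 show ?case by (simp add: presented_group_one wpow_def)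
next
  case (Suc n)
  interpret P: group "presented_group R" by (rule group_presented_group)
  have c: "pres_class R w \<in> carrier (presented_group R)" by (simp add: presented_group_carrier)
  have "wpow w (Suc n) = w @ wpow w n" by (simp add: wpow_def)
  then show ?case by (simp only: P.nat_pow_Suc2[OF c] Suc presented_group_mult)
qed

lemma presented_group_inv:
  "inv\<^bsub>presented_group R\<^esub> pres_class R w = pres_class R (winv w)"
proof -
  interpret P: group "presented_group R" by (rule group_presented_group)
  show ?thesis
    by (rule P.inv_equality)
      (simp_all add: presented_group_mult presented_group_one presented_group_carrier pres_class_eq_iff pres_eq_winv rangeI)
qed

lemma generate_presented_group:
  "generate (presented_group R) (range (\<lambda>x. pres_class R (wgen x))) = carrier (presented_group R)"
    (is "?gen = _")
proof
  interpret P: group "presented_group R" by (rule group_presented_group)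
  show "?gen \<subseteq> carrier (presented_group R)"
    by (rule P.generate_incl) (auto simp: presented_group_carrier)
  have "pres_class R w \<in> ?gen" for w
  proof (induction w)
    case Nil then show ?case using generate.one by (metis presented_group_one)
  next
    case (Cons p w)
    obtain x e where p: "p = (x, e)" by (cases p)
    have "winv (wgen x) = [(x, False)]" by (simp add: winv_def wgen_def)
    then have "pres_class R [(x, False)] \<in> ?gen"
      using generate.inv[of "pres_class R (wgen x)" _ "presented_group R"] presented_group_inv by (metis rangeI)
    moreover have "pres_class R [(x, True)] \<in> ?gen"
      by (rule generate.incl) (simp add: wgen_def)
    ultimately have "pres_class R [p] \<in> ?gen" using p by (cases e) auto
    then have "pres_class R [p] \<otimes>\<^bsub>presented_group R\<^esub> pres_class R w \<in> ?gen"
      using Cons by (rule generate.eng)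
    then show ?case by (simp add: presented_group_mult)
  qed
  then show "carrier (presented_group R) \<subseteq> ?gen" by (auto simp: presented_group_carrier)
qed

lemma range_two_gens: "range f = {f Gen_a, f Gen_b}"
proof -
  have "(UNIV :: two_gens set) = {Gen_a, Gen_b}" using two_gens.exhaust by auto
  then have "range f = f ` {Gen_a, Gen_b}" by (rule arg_cong)
  then show ?thesis by simp
qed

lemma (in group) conj_eq_iff:
  assumes "a \<in> carrier G" "b \<in> carrier G" "c \<in> carrier G"
  shows "inv b \<otimes> (a \<otimes> b) = c \<longleftrightarrow> a \<otimes> b = b \<otimes> c"
  using assms by (metis inv_closed inv_solve_left m_closed)

lemma metacyclic_iso:
  assumes "group H" "group G" and iso: "h \<in> iso H G" and m: "metacyclic H N t k a b"
  shows "metacyclic G N t k (h a) (h b)"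
proof -
  interpret group_hom H G h using assms by (simp add: group_hom_def group_hom_axioms_def iso_def)
  have ab: "a \<in> carrier H" "b \<in> carrier H" "a [^]\<^bsub>H\<^esub> N = \<one>\<^bsub>H\<^esub>" "b \<otimes>\<^bsub>H\<^esub> b = a [^]\<^bsub>H\<^esub> t"
    "a \<otimes>\<^bsub>H\<^esub> b = b \<otimes>\<^bsub>H\<^esub> a [^]\<^bsub>H\<^esub> k" and gen: "generate H {a, b} = carrier H"
    using m by (auto simp: metacyclic_def)
  have "h ` generate H {a, b} = generate G (h ` {a, b})"
    using ab(1,2) by (intro generate_img[symmetric]) simp
  then have "generate G {h a, h b} = carrier G" using gen iso by (simp add: iso_def bij_betw_def)
  moreover have "h a [^]\<^bsub>G\<^esub> N = \<one>\<^bsub>G\<^esub>" using ab by (metis hom_nat_pow hom_one)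
  moreover have "h b \<otimes>\<^bsub>G\<^esub> h b = h a [^]\<^bsub>G\<^esub> t" using ab by (metis hom_mult hom_nat_pow)
  moreover have "h a \<otimes>\<^bsub>G\<^esub> h b = h b \<otimes>\<^bsub>G\<^esub> h a [^]\<^bsub>G\<^esub> k"
  proof -
    have "h (a \<otimes>\<^bsub>H\<^esub> b) = h (b \<otimes>\<^bsub>H\<^esub> a [^]\<^bsub>H\<^esub> k)" using ab(5) by (rule arg_cong)
    then show ?thesis using ab(1,2) by (simp add: hom_nat_pow)
  qed
  ultimately show ?thesis using ab by (simp add: metacyclic_def)
qed

text \<open>One direction transports the generators along the isomorphism. In the other,
  \<open>metacyclic_order_le\<close> bounds the presented group by \<open>2 * N\<close>, and
  \<open>G\<close> supplies the matching lower bound.\<close>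

lemma iso_presented_iff_metacyclic:
  fixes G :: "('a, 'b) monoid_scheme"
  assumes "group G" and N: "N > 0" and o: "order G = 2 * N"
    and R: "metacyclic (presented_group R) N t k (pres_class R (wgen Gen_a)) (pres_class R (wgen Gen_b))"
    and sat: "\<And>(\<rho> :: two_gens \<Rightarrow> 'a) u v. metacyclic G N t k (\<rho> Gen_a) (\<rho> Gen_b) \<Longrightarrow> (u, v) \<in> R \<Longrightarrow>
      eval_word G \<rho> u = eval_word G \<rho> v"
  shows "G \<cong> presented_group R \<longleftrightarrow> (\<exists>a b. metacyclic G N t k a b)"
proof
  interpret group G by fact
  interpret P: group "presented_group R" by (rule group_presented_group)
  {
    assume "G \<cong> presented_group R"
    then obtain h where "h \<in> iso (presented_group R) G" using iso_sym by (auto simp: is_iso_def)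
    then show "\<exists>a b. metacyclic G N t k a b"
      using metacyclic_iso[OF group_presented_group assms(1) _ R] by blast
  next
    assume "\<exists>a b. metacyclic G N t k a b"
    then obtain a b where m: "metacyclic G N t k a b" by blast
    define \<rho> where "\<rho> x = (case x of Gen_a \<Rightarrow> a | Gen_b \<Rightarrow> b)" for x
    have \<rho>: "\<rho> Gen_a = a" "\<rho> Gen_b = b" by (simp_all add: \<rho>_def)
    have "a \<in> carrier G" "b \<in> carrier G" using m by (auto simp: metacyclic_def)
    then have "\<rho> x \<in> carrier G" for x by (cases x) (simp_all add: \<rho>)
    moreover have "generate G (range \<rho>) = carrier G"
      using m unfolding range_two_gens \<rho> by (simp add: metacyclic_def)
    moreover have "eval_word G \<rho> u = eval_word G \<rho> v" if "(u, v) \<in> R" for u v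
      using sat[of \<rho>] m that \<rho> by simp
    ultimately show "G \<cong> presented_group R"
      using P.metacyclic_order_le[OF R N] o by (intro iso_presented_group) auto
  }
qed

lemma (in monoid) nat_pow_2: "x \<in> carrier G \<Longrightarrow> x [^] (2::nat) = x \<otimes> x"
  by (simp add: numeral_2_eq_2)

lemma metacyclic_presented_group:
  assumes "pres_eq R (wpow (wgen Gen_a) N) []" "pres_eq R (wpow (wgen Gen_b) 2) (wpow (wgen Gen_a) t)"
    and "pres_eq R (wconj (wgen Gen_a) (wgen Gen_b)) (wpow (wgen Gen_a) k)"
  shows "metacyclic (presented_group R) N t k (pres_class R (wgen Gen_a)) (pres_class R (wgen Gen_b))"
    (is "metacyclic ?P _ _ _ ?a ?b")
proof -
  interpret P: group ?P by (rule group_presented_group)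
  have c: "?a \<in> carrier ?P" "?b \<in> carrier ?P" by (simp_all add: presented_group_carrier)
  have "?a [^]\<^bsub>?P\<^esub> N = \<one>\<^bsub>?P\<^esub>"
    unfolding presented_group_pow presented_group_one pres_class_eq_iff by (rule assms)
  moreover have "?b [^]\<^bsub>?P\<^esub> (2::nat) = ?a [^]\<^bsub>?P\<^esub> t"
    unfolding presented_group_pow pres_class_eq_iff by (rule assms)
  then have "?b \<otimes>\<^bsub>?P\<^esub> ?b = ?a [^]\<^bsub>?P\<^esub> t" using P.nat_pow_2[OF c(2)] by simp
  moreover have "inv\<^bsub>?P\<^esub> ?b \<otimes>\<^bsub>?P\<^esub> (?a \<otimes>\<^bsub>?P\<^esub> ?b) = ?a [^]\<^bsub>?P\<^esub> k"
    unfolding presented_group_pow presented_group_inv presented_group_mult pres_class_eq_iff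
    using assms(3) by (simp add: wconj_def)
  then have "?a \<otimes>\<^bsub>?P\<^esub> ?b = ?b \<otimes>\<^bsub>?P\<^esub> ?a [^]\<^bsub>?P\<^esub> k"
    using P.conj_eq_iff[OF c P.nat_pow_closed[OF c(1)]] by blast
  ultimately show ?thesis
    unfolding metacyclic_def using c generate_presented_group[of R] by (simp add: range_two_gens)
qed

lemma eval_word_metacyclic:
  assumes "group G" and m: "metacyclic G N t k (\<rho> Gen_a) (\<rho> Gen_b)"
  shows "eval_word G \<rho> (wpow (wgen Gen_a) n) = \<rho> Gen_a [^]\<^bsub>G\<^esub> n"
    "eval_word G \<rho> (wpow (wgen Gen_b) 2) = \<rho> Gen_a [^]\<^bsub>G\<^esub> t"
    "eval_word G \<rho> (wconj (wgen Gen_a) (wgen Gen_b)) = \<rho> Gen_a [^]\<^bsub>G\<^esub> k"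
    "eval_word G \<rho> [] = \<one>\<^bsub>G\<^esub>"
    "eval_word G \<rho> (winv (wgen Gen_a)) = inv\<^bsub>G\<^esub> \<rho> Gen_a"
proof -
  interpret group G by fact
  have ab: "\<rho> Gen_a \<in> carrier G" "\<rho> Gen_b \<in> carrier G" "\<rho> Gen_b \<otimes>\<^bsub>G\<^esub> \<rho> Gen_b = \<rho> Gen_a [^]\<^bsub>G\<^esub> t"
    "\<rho> Gen_a \<otimes>\<^bsub>G\<^esub> \<rho> Gen_b = \<rho> Gen_b \<otimes>\<^bsub>G\<^esub> \<rho> Gen_a [^]\<^bsub>G\<^esub> k"
    using m by (auto simp: metacyclic_def)
  have \<rho>: "\<rho> x \<in> carrier G" for x using ab by (cases x) auto
  note ev = eval_word_append[OF \<rho>] eval_word_wpow[OF \<rho>] eval_word_winv[OF \<rho>] eval_word_gen[OF \<rho>] eval_word_Nil[OF \<rho>]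
  show "eval_word G \<rho> (wpow (wgen Gen_a) n) = \<rho> Gen_a [^]\<^bsub>G\<^esub> n"
    "eval_word G \<rho> [] = \<one>\<^bsub>G\<^esub>" "eval_word G \<rho> (winv (wgen Gen_a)) = inv\<^bsub>G\<^esub> \<rho> Gen_a" by (simp_all add: ev)
  show "eval_word G \<rho> (wpow (wgen Gen_b) 2) = \<rho> Gen_a [^]\<^bsub>G\<^esub> t" using ab(3) nat_pow_2[OF ab(2)] by (simp add: ev)
  show "eval_word G \<rho> (wconj (wgen Gen_a) (wgen Gen_b)) = \<rho> Gen_a [^]\<^bsub>G\<^esub> k"
    using ab(4) conj_eq_iff[OF ab(1,2) nat_pow_closed[OF ab(1)], of k] unfolding wconj_def ev by blast
qed

text \<open>This covers both equality cases: \<open>k = 1\<close> gives the direct product, the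
  other exponent gives \<open>M_group\<close>.\<close>

lemma iso_split_presented_iff:
  assumes "group G" and N: "N > 0" and o: "order G = 2 * N"
  shows "G \<cong> presented_group {(wpow (wgen Gen_a) N, []), (wpow (wgen Gen_b) 2, []),
      (wconj (wgen Gen_a) (wgen Gen_b), wpow (wgen Gen_a) k)} \<longleftrightarrow> (\<exists>a b. metacyclic G N 0 k a b)"
    (is "G \<cong> presented_group ?R \<longleftrightarrow> _")
proof (rule iso_presented_iff_metacyclic[OF assms])
  show "metacyclic (presented_group ?R) N 0 k (pres_class ?R (wgen Gen_a)) (pres_class ?R (wgen Gen_b))"
    by (intro metacyclic_presented_group pres_eq.rel) (simp_all add: wpow_def)
next
  fix \<rho> :: "two_gens \<Rightarrow> 'a" and u v
  assume m: "metacyclic G N 0 k (\<rho> Gen_a) (\<rho> Gen_b)" and uv: "(u, v) \<in> ?R"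
  have "\<rho> Gen_a [^]\<^bsub>G\<^esub> N = \<one>\<^bsub>G\<^esub>" using m by (simp add: metacyclic_def)
  then show "eval_word G \<rho> u = eval_word G \<rho> v"
    using uv by (auto simp: eval_word_metacyclic[OF assms(1) m])
qed

lemma iso_M_group_iff:
  assumes "group G" and l: "l \<ge> 1" and o: "order G = 2 ^ l"
  shows "G \<cong> M_group l \<longleftrightarrow> (\<exists>a b. metacyclic G (2 ^ (l - 1)) 0 (1 + 2 ^ (l - 2)) a b)"
proof -
  have "order G = 2 * 2 ^ (l - 1)" using o l by (cases l) auto
  then show ?thesis unfolding M_group_def Let_def by (intro iso_split_presented_iff assms) simp_all
qed

text \<open>The presentation uses the formal inverse of the generator, \<open>metacyclic\<close> the
  positive exponent \<open>N - 1\<close>; the relation for the order of the generator translates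
  between them.\<close>

lemma iso_Q_group_iff:
  assumes "group G" and l: "l \<ge> 1" and o: "order G = 2 ^ l"
  shows "G \<cong> Q_group l \<longleftrightarrow> (\<exists>a b. metacyclic G (2 ^ (l - 1)) (2 ^ (l - 2)) (2 ^ (l - 1) - 1) a b)"
proof -
  have o': "order G = 2 * 2 ^ (l - 1)" using o l by (cases l) auto
  define N t :: nat where "N = 2 ^ (l - 1)" and "t = 2 ^ (l - 2)"
  have N: "N > 0" by (simp add: N_def)
  let ?R = "{(wpow (wgen Gen_a) N, []), (wpow (wgen Gen_b) 2, wpow (wgen Gen_a) t),
    (wconj (wgen Gen_a) (wgen Gen_b), winv (wgen Gen_a))}"
  let ?P = "presented_group ?R" and ?a = "pres_class ?R (wgen Gen_a)"
  interpret P: group ?P by (rule group_presented_group)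
  have aN: "pres_eq ?R (wpow (wgen Gen_a) N) []" by (rule pres_eq.rel) simp
  then have "?a [^]\<^bsub>?P\<^esub> N = \<one>\<^bsub>?P\<^esub>"
    unfolding presented_group_pow presented_group_one pres_class_eq_iff .
  then have "inv\<^bsub>?P\<^esub> ?a = ?a [^]\<^bsub>?P\<^esub> (N - 1)"
    using N by (intro P.inv_eq_pow_pred) (simp_all add: presented_group_carrier)
  then have ia: "pres_eq ?R (winv (wgen Gen_a)) (wpow (wgen Gen_a) (N - 1))"
    unfolding presented_group_pow presented_group_inv pres_class_eq_iff .
  have "G \<cong> ?P \<longleftrightarrow> (\<exists>a b. metacyclic G N t (N - 1) a b)"
  proof (rule iso_presented_iff_metacyclic[OF assms(1) N])
    show "order G = 2 * N" using o' by (simp add: N_def)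
    show "metacyclic ?P N t (N - 1) ?a (pres_class ?R (wgen Gen_b))"
    proof (rule metacyclic_presented_group[OF aN])
      show "pres_eq ?R (wpow (wgen Gen_b) 2) (wpow (wgen Gen_a) t)" by (rule pres_eq.rel) simp
      have "pres_eq ?R (wconj (wgen Gen_a) (wgen Gen_b)) (winv (wgen Gen_a))" by (rule pres_eq.rel) simp
      then show "pres_eq ?R (wconj (wgen Gen_a) (wgen Gen_b)) (wpow (wgen Gen_a) (N - 1))"
        using ia by (rule pres_eq.trans)
    qed
  next
    fix \<rho> :: "two_gens \<Rightarrow> 'a" and u v
    assume m: "metacyclic G N t (N - 1) (\<rho> Gen_a) (\<rho> Gen_b)" and uv: "(u, v) \<in> ?R"
    have r: "\<rho> Gen_a \<in> carrier G" "\<rho> Gen_a [^]\<^bsub>G\<^esub> N = \<one>\<^bsub>G\<^esub>" using m by (simp_all add: metacyclic_def)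
    then have "inv\<^bsub>G\<^esub> \<rho> Gen_a = \<rho> Gen_a [^]\<^bsub>G\<^esub> (N - 1)"
      using group.inv_eq_pow_pred[OF assms(1) r N] by simp
    then show "eval_word G \<rho> u = eval_word G \<rho> v"
      using uv r(2) by (auto simp: eval_word_metacyclic[OF assms(1) m])
  qed
  then show ?thesis unfolding Q_group_def Let_def N_def t_def .
qed

section \<open>Cyclic groups and their products with a group of order two\<close>

lemma DirProd_nat_pow:
  "(x, y) [^]\<^bsub>G \<times>\<times> H\<^esub> (n::nat) = (x [^]\<^bsub>G\<^esub> n, y [^]\<^bsub>H\<^esub> n)"
  by (induction n) (simp_all add: nat_pow_def)

lemma metacyclic_cyclic_times_two:
  assumes N: "N \<ge> 2"
  shows "\<exists>a b. metacyclic (integer_mod_group N \<times>\<times> integer_mod_group 2) N 0 1 a b"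
proof -
  let ?H = "integer_mod_group N \<times>\<times> integer_mod_group 2" and ?a = "(1::int, 0::int)" and ?b = "(0::int, 1::int)"
  interpret H: group ?H by (rule DirProd_group) simp_all
  have c: "?a \<in> carrier ?H" "?b \<in> carrier ?H" using N by auto
  let ?g = "generate ?H {?a, ?b}"
  have S: "subgroup ?g ?H" using c by (intro H.generate_is_subgroup) simp
  have pw: "x [^]\<^bsub>?H\<^esub> (n::nat) \<in> ?g" if "x \<in> {?a, ?b}" for x n
    using H.subgroup_int_pow_closed[OF S generate.incl[OF that], of "int n"] by (simp add: int_pow_int)
  have "carrier ?H \<subseteq> ?g"
  proof
    fix p assume p: "p \<in> carrier ?H"
    obtain i j where ij: "p = (i, j)" by (cases p)
    then have b: "0 \<le> i" "i < int N" "0 \<le> j" "j < 2" using p N by (auto simp: carrier_integer_mod_group)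
    have "?a [^]\<^bsub>?H\<^esub> nat i \<otimes>\<^bsub>?H\<^esub> ?b [^]\<^bsub>?H\<^esub> nat j \<in> ?g"
      using pw by (intro generate.eng) simp_all
    also have "?a [^]\<^bsub>?H\<^esub> nat i \<otimes>\<^bsub>?H\<^esub> ?b [^]\<^bsub>?H\<^esub> nat j = p"
      using b N by (simp add: DirProd_nat_pow ij)
    finally show "p \<in> ?g" .
  qed
  then have "?g = carrier ?H" using H.generate_incl[of "{?a, ?b}"] c by blast
  then have "metacyclic ?H N 0 1 ?a ?b"
    unfolding metacyclic_def using c N by (simp add: DirProd_nat_pow)
  then show ?thesis by blast
qed

text \<open>Both \<open>G\<close> and the direct product are compared with the same presented
  group.\<close>

lemma iso_cyclic_times_two_iff:
  assumes "group G" and l: "l \<ge> 2" and o: "order G = 2 ^ l"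
  shows "G \<cong> integer_mod_group (2 ^ (l - 1)) \<times>\<times> integer_mod_group 2 \<longleftrightarrow>
    (\<exists>a b. metacyclic G (2 ^ (l - 1)) 0 1 a b)"
proof -
  let ?N = "2 ^ (l - 1) :: nat"
  let ?H = "integer_mod_group ?N \<times>\<times> integer_mod_group 2"
  have o': "order G = 2 * ?N" using o l by (cases l) auto
  have "(2::nat) ^ 1 \<le> ?N" using l by (intro power_increasing) auto
  then have N: "?N \<ge> 2" by simp
  interpret H: group ?H by (rule DirProd_group) simp_all
  interpret group G by fact
  have oH: "order ?H = 2 * ?N" by (simp add: order_def carrier_integer_mod_group)
  note G = iso_split_presented_iff[OF assms(1) _ o', of 1] and H = iso_split_presented_iff[OF H.is_group _ oH, of 1]
  have HP: "?H \<cong> presented_group {(wpow (wgen Gen_a) ?N, []), (wpow (wgen Gen_b) 2, []),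
      (wconj (wgen Gen_a) (wgen Gen_b), wpow (wgen Gen_a) 1)}" (is "_ \<cong> ?P")
    using H metacyclic_cyclic_times_two[OF N] by simp
  have "G \<cong> ?H \<longleftrightarrow> G \<cong> ?P"
    using iso_trans[OF _ HP] iso_trans[OF _ H.iso_sym[OF HP]] by metis
  then show ?thesis using G by simp
qed

text \<open>Exponentiation of a generator is the isomorphism. The contrapositive turns the exclusion
  of the cyclic group into \<open>\<not> cyclic_group G\<close>.\<close>

lemma (in two_group) iso_integer_mod_group:
  assumes "cyclic_group G" shows "G \<cong> integer_mod_group (2 ^ l)"
proof -
  let ?Z = "integer_mod_group (2 ^ l)"
  interpret Z: group ?Z by simp
  obtain x where x: "x \<in> carrier G" "generate G {x} = carrier G" using assms cyclic_iff by blast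
  have ox: "ord x = 2 ^ l" using generate_pow_card[OF x(1)] x(2) card_carrier by simp
  define h where "h i = x [^] (i::int)" for i
  have heq: "h i = h j \<longleftrightarrow> int (2 ^ l) dvd j - i" for i j
    unfolding h_def using int_pow_eq[OF x(1)] ox by simp
  have "h \<in> hom ?Z G"
  proof (rule homI)
    fix i j
    have "h ((i + j) mod int (2 ^ l)) = h (i + j)" unfolding heq by (simp add: mod_eq_dvd_iff[symmetric])
    then show "h (i \<otimes>\<^bsub>?Z\<^esub> j) = h i \<otimes> h j" using x(1) by (simp add: h_def int_pow_mult)
  qed (use x in \<open>simp add: h_def\<close>)
  moreover have inj: "inj_on h (carrier ?Z)"
  proof (rule inj_onI)
    fix i j assume "i \<in> carrier ?Z" "j \<in> carrier ?Z" "h i = h j"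
    then show "i = j" unfolding heq
      by (simp add: carrier_integer_mod_group) (metis mod_eq_dvd_iff mod_pos_pos_trivial)
  qed
  moreover have "h ` carrier ?Z = carrier G"
  proof (rule card_subset_eq[OF fin])
    show "h ` carrier ?Z \<subseteq> carrier G" using x(1) by (auto simp: h_def)
    show "card (h ` carrier ?Z) = card (carrier G)"
      using card_image[OF inj] card_carrier by (simp add: carrier_integer_mod_group)
  qed
  ultimately have "h \<in> iso ?Z G" by (simp add: iso_def bij_betw_def)
  then show ?thesis using Z.iso_sym by (auto simp: is_iso_def)
qed

theorem theorem2:
  fixes G :: "('a, 'b) monoid_scheme" and l :: nat
  assumes "group G" and "order G = 2 ^ l"
  shows
    "(l \<ge> 5 \<and> \<not> G \<cong> integer_mod_group (2 ^ l) \<longrightarrow>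
        card (subgroups_of G) \<ge> 3 * l - 1 \<and>
        (card (subgroups_of G) = 3 * l - 1 \<longleftrightarrow>
           G \<cong> integer_mod_group (2 ^ (l - 1)) \<times>\<times> integer_mod_group 2 \<or> G \<cong> M_group l)) \<and>
     (l = 3 \<and> \<not> G \<cong> integer_mod_group 8 \<longrightarrow>
        card (subgroups_of G) \<ge> 6 \<and>
        (card (subgroups_of G) = 6 \<longleftrightarrow> G \<cong> Q_group 3)) \<and>
     (l = 4 \<and> \<not> G \<cong> integer_mod_group 16 \<longrightarrow>
        card (subgroups_of G) \<ge> 11 \<and>
        (card (subgroups_of G) = 11 \<longleftrightarrow>
           G \<cong> Q_group 4 \<or> G \<cong> M_group 4 \<or>
           G \<cong> integer_mod_group 8 \<times>\<times> integer_mod_group 2))"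
proof -
  have tg: "two_group G l" using assms by (simp add: two_group_def two_group_axioms_def)
  interpret two_group G l by (rule tg)
  let ?f = "card (subgroups_of G)"
  have split_iff: "(\<exists>a b. metacyclic G (2 ^ (l - 1)) 0 1 a b \<or> metacyclic G (2 ^ (l - 1)) 0 (1 + 2 ^ (l - 2)) a b)
      \<longleftrightarrow> G \<cong> integer_mod_group (2 ^ (l - 1)) \<times>\<times> integer_mod_group 2 \<or> G \<cong> M_group l" if "l \<ge> 4"
    using iso_cyclic_times_two_iff[OF assms(1) _ assms(2)] iso_M_group_iff[OF assms(1) _ assms(2)] that by auto
  have upper: "?f \<le> 3 * l - 1"
    if l: "l \<ge> 4" and m: "\<exists>a b. metacyclic G (2 ^ (l - 1)) 0 1 a b \<or> metacyclic G (2 ^ (l - 1)) 0 (1 + 2 ^ (l - 2)) a b"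
  proof -
    obtain m where lm: "l = m + 4" using l by (metis add.commute le_Suc_ex)
    have o: "order G = 2 * 2 ^ (l - 1)" using assms(2) l by (cases l) auto
    \<comment> \<open>The counting bound wants \<open>k + 1\<close> as twice an odd number, which
      for this exponent relies on \<open>l \<ge> 4\<close>.\<close>
    have k: "1 + 2 ^ (l - 2) + 1 = 2 * (1 + 2 * 2 ^ m :: nat)" using lm by (simp add: numeral_eq_Suc)
    obtain a b where "metacyclic G (2 ^ (l - 1)) 0 1 a b \<or> metacyclic G (2 ^ (l - 1)) 0 (1 + 2 ^ (l - 2)) a b"
      using m by blast
    then have "?f \<le> 3 * (l - 1) + 2"
    proof
      assume "metacyclic G (2 ^ (l - 1)) 0 1 a b"
      then show ?thesis using split_metacyclic_card_subgroups_le[OF _ o, of 1 a b 1] by simp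
    next
      assume "metacyclic G (2 ^ (l - 1)) 0 (1 + 2 ^ (l - 2)) a b"
      then show ?thesis using split_metacyclic_card_subgroups_le[OF _ o k] by simp
    qed
    then show ?thesis using lm by simp
  qed
  have part1: "?f \<ge> 3 * l - 1 \<and> (?f = 3 * l - 1 \<longleftrightarrow>
      G \<cong> integer_mod_group (2 ^ (l - 1)) \<times>\<times> integer_mod_group 2 \<or> G \<cong> M_group l)"
    if l: "l \<ge> 5" and nc: "\<not> G \<cong> integer_mod_group (2 ^ l)"
  proof -
    have nc': "\<not> cyclic_group G" using nc iso_integer_mod_group by blast
    have l4: "l \<ge> 4" using l by simp
    have ge: "?f \<ge> 3 * l - 1" by (rule card_subgroups_ge[OF tg l4 nc'])
    moreover have "?f = 3 * l - 1 \<longleftrightarrow>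
      (\<exists>a b. metacyclic G (2 ^ (l - 1)) 0 1 a b \<or> metacyclic G (2 ^ (l - 1)) 0 (1 + 2 ^ (l - 2)) a b)"
      using card_subgroups_eq_imp_metacyclic[OF tg l4 nc'] l upper[OF l4] ge by (metis le_antisym)
    ultimately show ?thesis using split_iff[OF l4] by simp
  qed
  have part2: "?f \<ge> 6 \<and> (?f = 6 \<longleftrightarrow> G \<cong> Q_group 3)"
    if l: "l = 3" and nc: "\<not> G \<cong> integer_mod_group 8"
  proof -
    have nc': "\<not> cyclic_group G" using nc iso_integer_mod_group l by auto
    have tg3: "two_group G 3" using tg l by simp
    have Q: "G \<cong> Q_group 3 \<longleftrightarrow> (\<exists>a b. metacyclic G 4 2 3 a b)"
      using iso_Q_group_iff[OF assms(1) _ assms(2)] l by simp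
    have up: "?f \<le> 6" if "metacyclic G 4 2 3 a b" for a b
      using quaternion_card_subgroups_le[of 2 a b] that assms(2) l by simp
    \<comment> \<open>A four-group yields 3 * 3 - 1 = 8 subgroups, so both sides of the equivalence
      fail: the count exceeds six, while Q_8 has at most six subgroups.\<close>
    show ?thesis
    proof (cases "has_klein G")
      case True
      then have "?f \<ge> 8" using klein_card_subgroups[OF tg3] by simp
      then show ?thesis using Q up by fastforce
    next
      case False
      then show ?thesis using order_8_no_klein[OF tg3 nc'] Q up by (metis le_antisym)
    qed
  qed
  have part3: "?f \<ge> 11 \<and> (?f = 11 \<longleftrightarrow> G \<cong> Q_group 4 \<or> G \<cong> M_group 4 \<or>
      G \<cong> integer_mod_group 8 \<times>\<times> integer_mod_group 2)"
    if l: "l = 4" and nc: "\<not> G \<cong> integer_mod_group 16"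
  proof -
    have nc': "\<not> cyclic_group G" using nc iso_integer_mod_group l by auto
    have tg4: "two_group G 4" and l4: "l \<ge> 4" using tg l by simp_all
    have Q: "G \<cong> Q_group 4 \<longleftrightarrow> (\<exists>a b. metacyclic G 8 4 7 a b)"
      using iso_Q_group_iff[OF assms(1) _ assms(2)] l by simp
    have upQ: "?f \<le> 11" if "metacyclic G 8 4 7 a b" for a b
      using quaternion_card_subgroups_le[of 3 a b] that assms(2) l by simp
    have ge: "?f \<ge> 11" using card_subgroups_ge[OF tg4 _ nc'] by simp
    have "?f = 11 \<longleftrightarrow> (\<exists>a b. metacyclic G 8 4 7 a b) \<or>
      (\<exists>a b. metacyclic G (2 ^ (l - 1)) 0 1 a b \<or> metacyclic G (2 ^ (l - 1)) 0 (1 + 2 ^ (l - 2)) a b)"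
      (is "_ \<longleftrightarrow> ?Q \<or> ?S")
    proof
      assume eq: "?f = 11"
      \<comment> \<open>With a four-group, the count 11 = 3 * 4 - 1 forces one of the two split
        cases; without one, the group is quaternion whatever the count.\<close>
      show "?Q \<or> ?S"
      proof (cases "has_klein G")
        case True
        then show ?thesis using card_subgroups_eq_imp_metacyclic[OF tg l4 nc'] eq l by simp
      next
        case False
        then show ?thesis using order_16_no_klein(2)[OF tg4 nc'] by blast
      qed
    next
      assume "?Q \<or> ?S"
      then have "?f \<le> 11" using upQ upper[OF l4] l by auto
      then show "?f = 11" using ge by simp
    qed
    then show ?thesis using ge Q split_iff[OF l4] l by auto
  qed
  from part1 part2 part3 show ?thesis by blast
qed

end
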